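(* Let $b$ be a positive integer and $\omega=e^{2\pi i/3}$. Let $\mathcal M_1=\{3,6\}_{b,0}$ be the regular map on the torus $\mathbb C/b\mathbb Z[\omega]$ and $\mathcal M_2=\{3,6\}_{b,b}$ the regular map on the torus $\mathbb C/(-b+b\omega)\mathbb Z[\omega]$, both induced by the tessellation of $\mathbb C$ by equilateral triangles with vertex set $\mathbb Z[\omega]$ (six triangles at each vertex). Then the pattern of a mirror of a reflection of $\mathcal M_1$ is $(\mathbf{01})^b$ or $(\mathbf{0212})^b$, and the pattern of a mirror of a reflection of $\mathcal M_2$ is $(\mathbf{01})^{3b}$ or $(\mathbf{0212})^b$.
   Context: The geometric points of a map are its vertices (denoted $\mathbf 0$), edge-centres (denoted $\mathbf 1$) and face-centres (denoted $\mathbf 2$). A reflection of the map is an orientation-reversing involutive automorphism; its fixed curves (mirrors) pass through geometric points, and the pattern of a mirror is the cyclic sequence of geometric points met along it, written $(\ell)^K$ to mean the word $\ell$ repeated $K$ times around the closed mirror (here $\ell$ is the minimal repeating block, and $K$ is the link index). *)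

theory Defs
  imports "HOL-Complex_Analysis.Complex_Analysis"
begin

definition omega :: complex where
  "omega = exp (2 * of_real pi * \<i> / 3)"

definition eisenstein :: "complex set" where
  "eisenstein = {of_int m + of_int n * omega | m n. True}"

definition plane_edges :: "complex set set" where
  "plane_edges = {closed_segment x y | x y. x \<in> eisenstein \<and> y \<in> eisenstein \<and> dist x y = 1}"

definition plane_faces :: "complex set set" where
  "plane_faces = {interior (convex hull {x, y, z}) | x y z.
     x \<in> eisenstein \<and> y \<in> eisenstein \<and> z \<in> eisenstein \<and>
     dist x y = 1 \<and> dist y z = 1 \<and> dist z x = 1}"

datatype geo = Vertex | Edge_Centre | Face_Centre

fun plane_points :: "geo \<Rightarrow> complex set" where
  "plane_points Vertex = eisenstein"
| "plane_points Edge_Centre =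
     {(x + y) / 2 | x y. x \<in> eisenstein \<and> y \<in> eisenstein \<and> dist x y = 1}"
| "plane_points Face_Centre =
     {(x + y + z) / 3 | x y z.
        x \<in> eisenstein \<and> y \<in> eisenstein \<and> z \<in> eisenstein \<and>
        dist x y = 1 \<and> dist y z = 1 \<and> dist z x = 1}"

text \<open>
  A point of the torus is a coset of the lattice \<open>\<Lambda>\<close>. The map that the tessellation induces on
  the torus is determined by \<open>\<Lambda>\<close>, so \<open>\<Lambda>\<close> is the parameter that names the map.
\<close>

definition proj :: "complex set \<Rightarrow> complex \<Rightarrow> complex set" where
  "proj \<Lambda> z = (\<lambda>l. z + l) ` \<Lambda>"

definition torus :: "complex set \<Rightarrow> complex set set" where
  "torus \<Lambda> = range (proj \<Lambda>)"

definition torus_topology :: "complex set \<Rightarrow> complex set topology" where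
  "torus_topology \<Lambda> = topology (\<lambda>U. U \<subseteq> torus \<Lambda> \<and> open (proj \<Lambda> -` U))"

lemma openin_torus_topology:
  "openin (torus_topology \<Lambda>) U \<longleftrightarrow> U \<subseteq> torus \<Lambda> \<and> open (proj \<Lambda> -` U)"
proof -
  have "istopology (\<lambda>U. U \<subseteq> torus \<Lambda> \<and> open (proj \<Lambda> -` U))"
    unfolding istopology_def by (auto simp: vimage_Union)
  then show ?thesis
    by (simp add: torus_topology_def topology_inverse')
qed

lemma topspace_torus_topology: "topspace (torus_topology \<Lambda>) = torus \<Lambda>"
proof -
  have "proj \<Lambda> -` torus \<Lambda> = UNIV"
    by (auto simp: torus_def)
  then have "openin (torus_topology \<Lambda>) (torus \<Lambda>)"
    by (simp add: openin_torus_topology)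
  then show ?thesis
    by (meson openin_subset openin_topspace openin_torus_topology subset_antisym)
qed

lemma quotient_map_proj: "quotient_map euclidean (torus_topology \<Lambda>) (proj \<Lambda>)"
  by (auto simp: quotient_map_def topspace_torus_topology openin_torus_topology torus_def
      vimage_def)

definition torus_edges :: "complex set \<Rightarrow> complex set set set" where
  "torus_edges \<Lambda> = (\<lambda>e. proj \<Lambda> ` e) ` plane_edges"

definition torus_faces :: "complex set \<Rightarrow> complex set set set" where
  "torus_faces \<Lambda> = (\<lambda>F. proj \<Lambda> ` F) ` plane_faces"

definition geo_points :: "complex set \<Rightarrow> geo \<Rightarrow> complex set set" where
  "geo_points \<Lambda> s = proj \<Lambda> ` plane_points s"

text \<open>The maps \<open>{3,6}\<close> with indices \<open>b,0\<close> and \<open>b,b\<close>, respectively.\<close>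

definition lattice_b_0 :: "nat \<Rightarrow> complex set" where
  "lattice_b_0 b = (\<lambda>x. of_nat b * x) ` eisenstein"

definition lattice_b_b :: "nat \<Rightarrow> complex set" where
  "lattice_b_b b = (\<lambda>x. (- of_nat b + of_nat b * omega) * x) ` eisenstein"

text \<open>
  Maps live on Riemann surfaces, and an orientation-reversing automorphism is an anticonformal
  self-bijection of the surface: in local coordinates it is the conjugate of a holomorphic function.
\<close>

definition anticonformal :: "complex set \<Rightarrow> (complex set \<Rightarrow> complex set) \<Rightarrow> bool" where
  "anticonformal \<Lambda> f \<longleftrightarrow>
     (\<forall>z. \<exists>r>0. \<exists>g. g holomorphic_on ball z r \<and>
        (\<forall>u \<in> ball z r. f (proj \<Lambda> u) = proj \<Lambda> (cnj (g u))))"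

definition preserves_map :: "complex set \<Rightarrow> (complex set \<Rightarrow> complex set) \<Rightarrow> bool" where
  "preserves_map \<Lambda> f \<longleftrightarrow>
     bij_betw f (torus \<Lambda>) (torus \<Lambda>) \<and>
     f ` geo_points \<Lambda> Vertex = geo_points \<Lambda> Vertex \<and>
     (\<lambda>e. f ` e) ` torus_edges \<Lambda> = torus_edges \<Lambda> \<and>
     (\<lambda>F. f ` F) ` torus_faces \<Lambda> = torus_faces \<Lambda>"

definition is_reflection :: "complex set \<Rightarrow> (complex set \<Rightarrow> complex set) \<Rightarrow> bool" where
  "is_reflection \<Lambda> f \<longleftrightarrow>
     preserves_map \<Lambda> f \<and> anticonformal \<Lambda> f \<and> (\<forall>p \<in> torus \<Lambda>. f (f p) = p)"

definition mirrors :: "complex set \<Rightarrow> (complex set \<Rightarrow> complex set) \<Rightarrow> complex set set set" where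
  "mirrors \<Lambda> f =
     connected_components_of (subtopology (torus_topology \<Lambda>) {p \<in> torus \<Lambda>. f p = p})"

definition simple_closed_param ::
  "complex set \<Rightarrow> complex set set \<Rightarrow> (real \<Rightarrow> complex set) \<Rightarrow> bool" where
  "simple_closed_param \<Lambda> C \<gamma> \<longleftrightarrow>
     pathin (torus_topology \<Lambda>) \<gamma> \<and> \<gamma> 0 = \<gamma> 1 \<and> inj_on \<gamma> {0..<1} \<and> \<gamma> ` {0..1} = C"

text \<open>
  \<open>reads \<Lambda> C w\<close>: going once around the closed curve \<open>C\<close>, from a suitable starting point, the
  geometric points met are, in this order, of the kinds listed in \<open>w\<close>. The freedom in the choice of
  the parametrisation makes \<open>w\<close> a cyclic word.
\<close>

definition reads :: "complex set \<Rightarrow> complex set set \<Rightarrow> geo list \<Rightarrow> bool" where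
  "reads \<Lambda> C w \<longleftrightarrow>
     (\<exists>\<gamma> ts. simple_closed_param \<Lambda> C \<gamma> \<and>
        sorted_wrt (<) ts \<and>
        set ts = {t \<in> {0..<1}. \<exists>s. \<gamma> t \<in> geo_points \<Lambda> s} \<and>
        list_all2 (\<lambda>t s. \<gamma> t \<in> geo_points \<Lambda> s) ts w)"

abbreviation word_power :: "'a list \<Rightarrow> nat \<Rightarrow> 'a list" where
  "word_power l k \<equiv> concat (replicate k l)"

definition has_pattern :: "complex set \<Rightarrow> complex set set \<Rightarrow> geo list \<Rightarrow> nat \<Rightarrow> bool" where
  "has_pattern \<Lambda> C l K \<longleftrightarrow>
     reads \<Lambda> C (word_power l K) \<and>
     (\<forall>u k. word_power u k = word_power l K \<longrightarrow> length l \<le> length u)"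

end

theory Submission
  imports Defs
begin

text \<open>
  The local lifts of an anticonformal automorphism of the torus have derivatives that patch together
  to a \<open>\<Lambda>\<close>-periodic entire function, so by Liouville's theorem the automorphism is induced by an
  affine map \<open>u \<mapsto> \<alpha> * cnj u + \<beta>\<close>. Being an involution that preserves the vertices forces \<open>\<alpha>\<close> to be
  a unit \<open>\<plusminus> \<rho>\<^sup>2\<close> of the Eisenstein integers with \<open>\<rho>\<^sup>3 = 1\<close>, and \<open>\<beta>\<close> to be an Eisenstein integer. After
  changing \<open>\<beta>\<close> by an element of \<open>\<Lambda>\<close>, a given mirror is the image of the axis of this plane reflection,
  and the axis is a line through a vertex with direction \<open>\<rho>\<close> or \<open>\<rho> * (1 + 2 * omega)\<close>, the latter
  of length \<open>sqrt 3\<close>. On these two lines the geometric points repeat as \<open>01\<close> and as \<open>0212\<close>,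
  once per step of length \<open>1\<close> and \<open>sqrt 3\<close> respectively, and the link index is the number of such
  steps in the shortest lattice vector along the line.
\<close>

section \<open>The Eisenstein integers and the points of the tessellation\<close>

lemma omega_eq: "omega = Complex (- 1 / 2) (sqrt 3 / 2)"
proof -
  have "omega = cis (2 * pi / 3)"
    unfolding omega_def cis_conv_exp by (simp add: field_simps)
  then show ?thesis
    by (simp add: complex_eq_iff cos_120 sin_120)
qed

lemma Re_omega [simp]: "Re omega = - 1 / 2" and Im_omega [simp]: "Im omega = sqrt 3 / 2"
  by (simp_all add: omega_eq)

lemma cnj_omega: "cnj omega = - 1 - omega"
  by (simp add: complex_eq_iff)

lemma omega_square: "omega * omega = - 1 - omega"
  by (simp add: complex_eq_iff)

lemma omega_cube: "omega * (omega * omega) = 1"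
  by (simp add: omega_square complex_eq_iff)

lemma norm_omega [simp]: "norm omega = 1"
  by (simp add: cmod_def power2_eq_square)

section \<open>Coordinates with respect to the basis \<open>1\<close>, \<open>omega\<close>, and the
  ring of Eisenstein integers\<close>

lemma real_coords_eq_iff:
  "of_real x + of_real y * omega = of_real x' + of_real y' * omega \<longleftrightarrow> x = x' \<and> y = y'"
  by (auto simp: complex_eq_iff)

lemma real_coords_exist: obtains x y where "z = of_real x + of_real y * omega"
proof
  show "z = of_real (Re z + Im z / sqrt 3) + of_real (2 * Im z / sqrt 3) * omega"
    by (simp add: complex_eq_iff)
qed

lemma eisenstein_iff:
  "z \<in> eisenstein \<longleftrightarrow> (\<exists>m n :: int. z = of_real (of_int m) + of_real (of_int n) * omega)"
  by (auto simp: eisenstein_def)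

lemma real_coords_in_eisenstein_iff:
  "of_real x + of_real y * omega \<in> eisenstein \<longleftrightarrow> x \<in> \<int> \<and> y \<in> \<int>"
  unfolding eisenstein_iff real_coords_eq_iff by (auto elim!: Ints_cases)

lemma int_coords_in_eisenstein: "of_int m + of_int n * omega \<in> eisenstein"
  by (auto simp: eisenstein_def)

lemma eisenstein_0 [simp]: "0 \<in> eisenstein"
  using int_coords_in_eisenstein[of 0 0] by simp

lemma eisenstein_1 [simp]: "1 \<in> eisenstein"
  using int_coords_in_eisenstein[of 1 0] by simp

lemma eisenstein_omega [simp]: "omega \<in> eisenstein"
  using int_coords_in_eisenstein[of 0 1] by simp

lemma eisenstein_add: "x \<in> eisenstein \<Longrightarrow> y \<in> eisenstein \<Longrightarrow> x + y \<in> eisenstein"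
  unfolding eisenstein_def
  apply clarsimp
  subgoal for m m' n n'
    by (rule exI[of _ "m + m'"], rule exI[of _ "n + n'"]) (simp add: algebra_simps)
  done

lemma eisenstein_uminus: "x \<in> eisenstein \<Longrightarrow> - x \<in> eisenstein"
  unfolding eisenstein_def
  apply clarsimp
  subgoal for m n
    by (rule exI[of _ "- m"], rule exI[of _ "- n"]) (simp add: algebra_simps)
  done

lemma eisenstein_diff: "x \<in> eisenstein \<Longrightarrow> y \<in> eisenstein \<Longrightarrow> x - y \<in> eisenstein"
  using eisenstein_add[of x "- y"] eisenstein_uminus[of y] by simp

lemma eisenstein_mult:
  assumes "x \<in> eisenstein" "y \<in> eisenstein" shows "x * y \<in> eisenstein"
proof -
  obtain m n m' n' where
    xy: "x = of_int m + of_int n * omega" "y = of_int m' + of_int n' * omega"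
    using assms unfolding eisenstein_def by blast
  have "x * y = of_int m * of_int m' + (of_int m * of_int n' + of_int n * of_int m') * omega
      + of_int n * of_int n' * (omega * omega)"
    by (simp add: xy algebra_simps)
  also have "\<dots> = of_int (m * m' - n * n') + of_int (m * n' + n * m' - n * n') * omega"
    by (simp add: omega_square algebra_simps)
  finally show ?thesis
    by (simp only: int_coords_in_eisenstein)
qed

lemma eisenstein_of_int [simp]: "of_int k \<in> eisenstein"
  using int_coords_in_eisenstein[of k 0] by simp

lemma eisenstein_of_nat [simp]: "of_nat k \<in> eisenstein"
  using eisenstein_of_int[of "int k"] by simp

lemma eisenstein_cnj: "x \<in> eisenstein \<Longrightarrow> cnj x \<in> eisenstein"
proof -
  assume "x \<in> eisenstein"
  then obtain m n where x: "x = of_int m + of_int n * omega"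
    unfolding eisenstein_def by blast
  have "cnj x = of_int (m - n) + of_int (- n) * omega"
    by (simp add: x cnj_omega algebra_simps)
  then show ?thesis
    by (simp only: int_coords_in_eisenstein)
qed

section \<open>The norm form and the elements of norm one\<close>

lemma norm_int_coords_square:
  "(norm (of_int m + of_int n * omega))\<^sup>2 = of_int (m * m - m * n + n * n)"
proof -
  have s: "sqrt 3 * (sqrt 3 * x) = 3 * x" for x
    using real_sqrt_mult_self[of 3] by (simp flip: mult.assoc)
  show ?thesis
    unfolding cmod_power2 by (simp add: power2_eq_square algebra_simps s)
qed

lemma norm_int_coords_eq_1_iff:
  "norm (of_int m + of_int n * omega) = 1 \<longleftrightarrow>
     (m, n) \<in> {(1, 0), (- 1, 0), (0, 1), (0, - 1), (1, 1), (- 1, - 1)}"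
proof -
  have "norm (of_int m + of_int n * omega) = 1 \<longleftrightarrow> (norm (of_int m + of_int n * omega))\<^sup>2 = 1"
    by (simp add: power2_eq_1_iff) (metis norm_ge_zero neg_0_le_iff_le not_one_le_zero)
  also have "\<dots> \<longleftrightarrow> m * m - m * n + n * n = 1"
    unfolding norm_int_coords_square by linarith
  also have "\<dots> \<longleftrightarrow> (m, n) \<in> {(1, 0), (- 1, 0), (0, 1), (0, - 1), (1, 1), (- 1, - 1)}"
  proof
    assume eq: "m * m - m * n + n * n = 1"
    \<comment> \<open>Completing the square: four times the norm form is
      \<open>(2 * l - k) * (2 * l - k) + 3 * (k * k)\<close>, which leaves only
      \<open>k * k \<le> 1\<close>. The form is symmetric, so the bound serves both coordinates and
      six pairs survive.\<close>
    have bound: "k \<in> {-1, 0, 1}" if "(2 * l - k) * (2 * l - k) + 3 * (k * k) = 4" for k l :: int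
    proof -
      have "k * k \<le> 1"
        using that zero_le_square[of "2 * l - k"] by linarith
      then have "\<bar>k\<bar> \<le> 1"
        using abs_square_le_1[of k] by (simp add: power2_eq_square)
      then show ?thesis by auto
    qed
    have "m \<in> {-1, 0, 1}" "n \<in> {-1, 0, 1}"
      using eq bound[of n m] bound[of m n] by (simp_all add: algebra_simps)
    then show "(m, n) \<in> {(1, 0), (- 1, 0), (0, 1), (0, - 1), (1, 1), (- 1, - 1)}"
      using eq by auto
  qed auto
  finally show ?thesis .
qed

lemma dist_int_coords_eq_1_iff:
  "dist (of_int m + of_int n * omega) (of_int m' + of_int n' * omega) = 1 \<longleftrightarrow>
     (m' - m, n' - n) \<in> {(1, 0), (- 1, 0), (0, 1), (0, - 1), (1, 1), (- 1, - 1)}"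
proof -
  have "dist (of_int m + of_int n * omega) (of_int m' + of_int n' * omega)
      = norm (of_int (m' - m) + of_int (n' - n) * omega)"
    unfolding dist_norm by (subst norm_minus_commute) (simp add: algebra_simps)
  then show ?thesis
    by (simp only: norm_int_coords_eq_1_iff)
qed

text \<open>The squared norm is a positive integer. This gap around \<open>0\<close> is the source
  of all later discreteness arguments.\<close>

lemma eisenstein_norm_ge_1:
  assumes "x \<in> eisenstein" "x \<noteq> 0" shows "norm x \<ge> 1"
proof -
  obtain m n where x: "x = of_int m + of_int n * omega"
    using assms unfolding eisenstein_def by blast
  have "of_int (m * m - m * n + n * n) > (0::real)"
    using assms(2) unfolding x norm_int_coords_square[symmetric] by simp
  then have "1 \<le> m * m - m * n + n * n"
    by linarith
  then have "1 \<le> (of_int (m * m - m * n + n * n) :: real)"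
    by linarith
  then have "1 \<le> (norm x)\<^sup>2"
    unfolding x norm_int_coords_square .
  then show ?thesis
    using power2_le_imp_le[of 1 "norm x"] by simp
qed

section \<open>Cube roots of unity and the six units\<close>

definition cube_roots :: "complex set" where
  "cube_roots = {1, omega, omega * omega}"

lemma cube_roots_eisenstein: "\<rho> \<in> cube_roots \<Longrightarrow> \<rho> \<in> eisenstein"
  by (auto simp: cube_roots_def intro: eisenstein_mult)

lemma cube_roots_norm: "\<rho> \<in> cube_roots \<Longrightarrow> norm \<rho> = 1"
  by (auto simp: cube_roots_def norm_mult)

lemma cube_roots_cnj: "\<rho> \<in> cube_roots \<Longrightarrow> cnj \<rho> \<in> cube_roots"
  by (auto simp: cube_roots_def cnj_omega omega_square)

lemma cube_roots_mult_cnj: "\<rho> \<in> cube_roots \<Longrightarrow> cnj \<rho> * \<rho> = 1"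
  by (metis cube_roots_norm complex_norm_square mult.commute of_real_1 one_power2)

text \<open>Squaring permutes the cube roots of unity, so \<plusminus> their squares are all six
  units. Squares are wanted because the rotation by \<rho> conjugates
  \<open>w \<mapsto> \<plusminus> cnj w\<close> into
  \<open>u \<mapsto> \<plusminus> (\<rho> * \<rho>) * cnj u\<close>.\<close>

lemma eisenstein_unit_cube_root:
  assumes "x \<in> eisenstein" "norm x = 1"
  shows "\<exists>\<rho>\<in>cube_roots. x = \<rho> * \<rho> \<or> x = - (\<rho> * \<rho>)"
proof -
  obtain m n where x: "x = of_int m + of_int n * omega"
    using assms unfolding eisenstein_def by blast
  have "omega * omega * (omega * omega) = omega"
    using omega_cube by (simp add: mult.assoc)
  then show ?thesis
    using assms(2) omega_square unfolding x norm_int_coords_eq_1_iff cube_roots_def by auto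
qed

section \<open>Congruence conditions for edge-centres and face-centres\<close>

lemma real_coords_in_edge_centres_iff:
  "of_real x + of_real y * omega \<in> plane_points Edge_Centre \<longleftrightarrow>
     (\<exists>m n :: int. x = of_int m / 2 \<and> y = of_int n / 2 \<and> \<not> (even m \<and> even n))"
  (is "?z \<in> _ \<longleftrightarrow> ?R")
proof
  assume "?z \<in> plane_points Edge_Centre"
  then obtain p q where pq: "?z = (p + q) / 2" "p \<in> eisenstein" "q \<in> eisenstein" "dist p q = 1"
    by auto
  obtain m n m' n' where p: "p = of_int m + of_int n * omega"
    and q: "q = of_int m' + of_int n' * omega"
    using pq(2,3) unfolding eisenstein_def by blast
  have "?z = of_real (of_int (m + m') / 2) + of_real (of_int (n + n') / 2) * omega"
    unfolding pq(1) p q by (simp add: add_divide_distrib algebra_simps)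
  then have "x = of_int (m + m') / 2 \<and> y = of_int (n + n') / 2"
    unfolding real_coords_eq_iff .
  moreover have "\<not> (even (m + m') \<and> even (n + n'))"
    using pq(4) unfolding p q dist_int_coords_eq_1_iff insert_iff prod.inject empty_iff
    by presburger
  ultimately show ?R
    by blast
next
  assume ?R
  then obtain m n :: int where mn: "x = of_int m / 2" "y = of_int n / 2" "\<not> (even m \<and> even n)"
    by blast
  \<comment> \<open>Rounding the coordinates of the point down gives one end \<open>p\<close> of the
    edge, and reflecting \<open>p\<close> in the point gives the other end \<open>q\<close>. The
    difference \<open>q - p\<close> has the parities of \<open>m\<close> and \<open>n\<close> as
    coordinates, so it is \<open>1\<close>, \<open>omega\<close> or \<open>1 + omega\<close>, each
    of norm one.\<close>
  define i j where "i = m div 2" and "j = n div 2"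
  define p where "p = of_int i + of_int j * omega"
  define q where "q = of_int (m - i) + of_int (n - j) * omega"
  have "(m - i - i = 1 \<and> n - j - j = 0) \<or> (m - i - i = 0 \<and> n - j - j = 1)
      \<or> (m - i - i = 1 \<and> n - j - j = 1)"
    using mn(3) unfolding i_def j_def by presburger
  then have "dist p q = 1"
    unfolding p_def q_def dist_int_coords_eq_1_iff by auto
  moreover have "?z = (p + q) / 2"
    unfolding mn p_def q_def by (simp add: add_divide_distrib algebra_simps)
  moreover have "p \<in> eisenstein" "q \<in> eisenstein"
    unfolding p_def q_def by (rule int_coords_in_eisenstein)+
  ultimately show "?z \<in> plane_points Edge_Centre"
    by auto
qed

text \<open>A finite check over two sides of a triangle issuing from a common corner. It supplies
  the congruences for three times the centroid, taken relative to that corner.\<close>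

lemma unit_coords_sum_mod_3:
  fixes i j i' j' :: int
  assumes "(i, j) \<in> {(1, 0), (- 1, 0), (0, 1), (0, - 1), (1, 1), (- 1, - 1)}"
    and "(i', j') \<in> {(1, 0), (- 1, 0), (0, 1), (0, - 1), (1, 1), (- 1, - 1)}"
    and "(i' - i, j' - j) \<in> {(1, 0), (- 1, 0), (0, 1), (0, - 1), (1, 1), (- 1, - 1)}"
  shows "3 dvd i + i' + (j + j')" and "\<not> 3 dvd j + j'"
  using assms(1,2)
  by (elim insertE emptyE Pair_inject; insert assms(3); simp)+

text \<open>The condition \<open>3 dvd m + n\<close> says that \<open>m + n * omega\<close> is a
  multiple of \<open>1 + 2 * omega\<close>, the prime above 3. The face-centres are thus the
  Eisenstein integers divided by \<open>1 + 2 * omega\<close>, with the Eisenstein integers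
  themselves removed.\<close>

lemma real_coords_in_face_centres_iff:
  "of_real x + of_real y * omega \<in> plane_points Face_Centre \<longleftrightarrow>
     (\<exists>m n :: int. x = of_int m / 3 \<and> y = of_int n / 3 \<and> 3 dvd m + n \<and> \<not> 3 dvd n)"
  (is "?z \<in> _ \<longleftrightarrow> ?R")
proof
  assume "?z \<in> plane_points Face_Centre"
  then obtain p q r where pqr: "?z = (p + q + r) / 3" "p \<in> eisenstein" "q \<in> eisenstein"
    "r \<in> eisenstein" "dist p q = 1" "dist q r = 1" "dist r p = 1"
    by auto
  obtain m n m' n' m'' n'' where p: "p = of_int m + of_int n * omega"
    and q: "q = of_int m' + of_int n' * omega" and r: "r = of_int m'' + of_int n'' * omega"
    using pqr(2-4) unfolding eisenstein_def by blast
  have "?z = of_real (of_int (m + m' + m'') / 3) + of_real (of_int (n + n' + n'') / 3) * omega"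
    unfolding pqr(1) p q r by (simp add: add_divide_distrib algebra_simps)
  then have "x = of_int (m + m' + m'') / 3 \<and> y = of_int (n + n' + n'') / 3"
    unfolding real_coords_eq_iff .
  moreover have "3 dvd (m + m' + m'') + (n + n' + n'') \<and> \<not> 3 dvd n + n' + n''"
  proof -
    have diffs: "(m'' - m) - (m' - m) = m'' - m'" "(n'' - n) - (n' - n) = n'' - n'"
      by simp_all
    have "dist p r = 1"
      using pqr(7) by (simp only: dist_commute)
    then have "3 dvd (m' - m) + (m'' - m) + ((n' - n) + (n'' - n))" "\<not> 3 dvd (n' - n) + (n'' - n)"
      using unit_coords_sum_mod_3[of "m' - m" "n' - n" "m'' - m" "n'' - n", unfolded diffs] pqr(5,6)
      unfolding p q r dist_int_coords_eq_1_iff by blast+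
    then show ?thesis
      by presburger
  qed
  ultimately show ?R
    by blast
next
  assume ?R
  then obtain m n :: int where mn: "x = of_int m / 3" "y = of_int n / 3" "3 dvd m + n" "\<not> 3 dvd n"
    by blast
  have "\<exists>k l. (n = 3 * k + 2 \<and> m = 3 * l + 1) \<or> (n = 3 * k + 1 \<and> m = 3 * l + 2)"
    using mn(3,4) by presburger
  then obtain k l where kl: "(n = 3 * k + 2 \<and> m = 3 * l + 1) \<or> (n = 3 * k + 1 \<and> m = 3 * l + 2)"
    by blast
  \<comment> \<open>The two residue cases are the two triangles on the edge from \<open>p\<close> to
    \<open>q = p + 1 + omega\<close>. The third corner \<open>r\<close> is three times the centroid
    minus \<open>p\<close> and \<open>q\<close>, which is \<open>p + omega\<close> in one case and
    \<open>p + 1\<close> in the other.\<close>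
  define i j where "i = m - (l + (l + 1))" and "j = n - (k + (k + 1))"
  have ij: "(i = l \<and> j = k + 1) \<or> (i = l + 1 \<and> j = k)"
    using kl unfolding i_def j_def by auto
  define p q r where "p = of_int l + of_int k * omega"
    and "q = of_int (l + 1) + of_int (k + 1) * omega" and "r = of_int i + of_int j * omega"
  have "dist p q = 1" "dist q r = 1" "dist r p = 1"
    unfolding p_def q_def r_def dist_int_coords_eq_1_iff using ij by auto
  moreover have "?z = (p + q + r) / 3"
    unfolding mn p_def q_def r_def i_def j_def by (simp add: add_divide_distrib algebra_simps)
  moreover have "p \<in> eisenstein" "q \<in> eisenstein" "r \<in> eisenstein"
    unfolding p_def q_def r_def by (rule int_coords_in_eisenstein)+
  ultimately show "?z \<in> plane_points Face_Centre"
    by auto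
qed

section \<open>Translations and rotations preserve the kinds of geometric points\<close>

lemma plane_points_similarity:
  assumes a: "a \<in> eisenstein" "norm a = 1" and v: "v \<in> eisenstein" and z: "z \<in> plane_points s"
  shows "v + a * z \<in> plane_points s"
proof -
  \<comment> \<open>The affine map keeps vertices and distances, and affine maps commute with
    midpoints and centroids. Hence edges go to edges and triangles to triangles, together with their
    centres.\<close>
  have E: "v + a * x \<in> eisenstein" if "x \<in> eisenstein" for x
    using a v that by (intro eisenstein_add eisenstein_mult)
  have D: "dist (v + a * x) (v + a * y) = dist x y" for x y
    using a(2) by (simp add: dist_norm norm_mult flip: right_diff_distrib)
  show ?thesis
  proof (cases s)
    case Vertex
    then show ?thesis using z E by simp
  next
    case Edge_Centre
    then obtain x y where z_eq: "z = (x + y) / 2" and xy: "x \<in> eisenstein" "y \<in> eisenstein" "dist x y = 1"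
      using z unfolding Edge_Centre plane_points.simps by blast
    have "v + a * z = ((v + a * x) + (v + a * y)) / 2"
      unfolding z_eq by (simp add: field_simps)
    moreover have "dist (v + a * x) (v + a * y) = 1"
      using xy by (simp only: D)
    ultimately show ?thesis
      using E[OF xy(1)] E[OF xy(2)] unfolding Edge_Centre plane_points.simps by blast
  next
    case Face_Centre
    then obtain x y w where z_eq: "z = (x + y + w) / 3"
      and xy: "x \<in> eisenstein" "y \<in> eisenstein" "w \<in> eisenstein"
      "dist x y = 1" "dist y w = 1" "dist w x = 1"
      using z unfolding Face_Centre plane_points.simps by blast
    have "v + a * z = ((v + a * x) + (v + a * y) + (v + a * w)) / 3"
      unfolding z_eq by (simp add: field_simps)
    moreover have "dist (v + a * x) (v + a * y) = 1" "dist (v + a * y) (v + a * w) = 1"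
      "dist (v + a * w) (v + a * x) = 1"
      using xy by (simp_all only: D)
    ultimately show ?thesis
      using E[OF xy(1)] E[OF xy(2)] E[OF xy(3)] unfolding Face_Centre plane_points.simps by blast
  qed
qed

lemma plane_points_translate_iff:
  assumes "v \<in> eisenstein"
  shows "v + z \<in> plane_points s \<longleftrightarrow> z \<in> plane_points s"
proof
  show "v + z \<in> plane_points s" if "z \<in> plane_points s"
    using plane_points_similarity[OF eisenstein_1 norm_one assms that] by (simp only: mult_1)
  show "z \<in> plane_points s" if "v + z \<in> plane_points s"
    using plane_points_similarity[OF eisenstein_1 norm_one eisenstein_uminus[OF assms] that]
    by (simp only: mult_1 minus_add_cancel)
qed

lemma plane_points_rotate_iff:
  assumes "\<rho> \<in> cube_roots"
  shows "\<rho> * z \<in> plane_points s \<longleftrightarrow> z \<in> plane_points s"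
proof -
  have "cnj \<rho> * (\<rho> * z) = z"
    using cube_roots_mult_cnj[OF assms] by (simp flip: mult.assoc)
  moreover have "0 + \<rho> * z \<in> plane_points s" if "z \<in> plane_points s"
    using assms that
    by (intro plane_points_similarity) (simp_all add: cube_roots_eisenstein cube_roots_norm)
  moreover have "0 + cnj \<rho> * (\<rho> * z) \<in> plane_points s" if "\<rho> * z \<in> plane_points s"
    using assms that
    by (intro plane_points_similarity)
      (simp_all add: cube_roots_eisenstein cube_roots_norm cube_roots_cnj)
  ultimately show ?thesis
    by (metis add_0)
qed

section \<open>Anticonformal maps of the torus\<close>

text \<open>Inclusion in \<open>eisenstein\<close> makes \<Lambda> discrete and lets the
  tessellation descend to the torus. The multiples of \<open>N\<close> give \<Lambda> full rank, so
  that every coset meets a fixed disc.\<close>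

locale eisenstein_lattice =
  fixes \<Lambda> :: "complex set" and N :: nat
  assumes subset: "\<Lambda> \<subseteq> eisenstein"
    and zero: "0 \<in> \<Lambda>"
    and add: "x \<in> \<Lambda> \<Longrightarrow> y \<in> \<Lambda> \<Longrightarrow> x + y \<in> \<Lambda>"
    and uminus: "x \<in> \<Lambda> \<Longrightarrow> - x \<in> \<Lambda>"
    and N_pos: "N > 0"
    and multiples: "x \<in> eisenstein \<Longrightarrow> of_nat N * x \<in> \<Lambda>"
begin

lemma diff: "x \<in> \<Lambda> \<Longrightarrow> y \<in> \<Lambda> \<Longrightarrow> x - y \<in> \<Lambda>"
  using add[of x "- y"] uminus[of y] by simp

lemma norm_ge_1: "x \<in> \<Lambda> \<Longrightarrow> x \<noteq> 0 \<Longrightarrow> norm x \<ge> 1"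
  using subset eisenstein_norm_ge_1 by blast

lemma proj_eq_iff: "proj \<Lambda> x = proj \<Lambda> y \<longleftrightarrow> x - y \<in> \<Lambda>"
proof
  assume "proj \<Lambda> x = proj \<Lambda> y"
  moreover have "x \<in> proj \<Lambda> x"
    using zero by (force simp: proj_def)
  ultimately obtain l where "l \<in> \<Lambda>" "x = y + l"
    by (auto simp: proj_def)
  then show "x - y \<in> \<Lambda>" by simp
next
  assume xy: "x - y \<in> \<Lambda>"
  show "proj \<Lambda> x = proj \<Lambda> y"
  proof (intro equalityI subsetI)
    fix z assume "z \<in> proj \<Lambda> x"
    then obtain l where "l \<in> \<Lambda>" "z = x + l" by (auto simp: proj_def)
    then show "z \<in> proj \<Lambda> y"
      using add[OF xy, of l] by (auto simp: proj_def image_iff intro!: bexI[of _ "x - y + l"])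
  next
    fix z assume "z \<in> proj \<Lambda> y"
    then obtain l where "l \<in> \<Lambda>" "z = y + l" by (auto simp: proj_def)
    then show "z \<in> proj \<Lambda> x"
      using diff[of l, OF _ xy] by (auto simp: proj_def image_iff intro!: bexI[of _ "l - (x - y)"])
  qed
qed

text \<open>Representatives of a coset differ by translations that preserve the tessellation, so the
  kind of a point can be tested on any one of them.\<close>

lemma proj_in_geo_points_iff: "proj \<Lambda> z \<in> geo_points \<Lambda> s \<longleftrightarrow> z \<in> plane_points s"
proof
  assume "proj \<Lambda> z \<in> geo_points \<Lambda> s"
  then obtain w where w: "w \<in> plane_points s" "z - w \<in> \<Lambda>"
    by (auto simp: geo_points_def proj_eq_iff)
  then have "(z - w) + w \<in> plane_points s"
    using subset plane_points_translate_iff by blast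
  then show "z \<in> plane_points s" by simp
qed (auto simp: geo_points_def)

text \<open>Round the coordinates of \<open>z / of_nat N\<close> down: each fractional part is at
  most \<open>1\<close>, and both basis vectors have norm \<open>1\<close>.\<close>

lemma bounded_representative: "\<exists>l\<in>\<Lambda>. norm (z - l) \<le> 2 * N"
proof -
  obtain x y where z: "z / of_nat N = of_real x + of_real y * omega"
    by (rule real_coords_exist)
  define l where "l = of_nat N * (of_int \<lfloor>x\<rfloor> + of_int \<lfloor>y\<rfloor> * omega)"
  have "z - l = of_nat N * (z / of_nat N - (of_int \<lfloor>x\<rfloor> + of_int \<lfloor>y\<rfloor> * omega))"
    using N_pos by (simp add: l_def right_diff_distrib)
  also have "\<dots> = of_nat N * (of_real (x - of_int \<lfloor>x\<rfloor>) + of_real (y - of_int \<lfloor>y\<rfloor>) * omega)"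
    by (simp add: z algebra_simps)
  also have "norm \<dots> \<le> N * (\<bar>x - of_int \<lfloor>x\<rfloor>\<bar> + \<bar>y - of_int \<lfloor>y\<rfloor>\<bar>)"
    unfolding norm_mult norm_of_nat
    by (intro mult_left_mono order.trans[OF norm_triangle_ineq])
      (simp_all only: norm_mult norm_of_real norm_omega mult_1_right of_nat_0_le_iff order_refl)
  also have "\<dots> \<le> real N * 2"
    by (intro mult_left_mono) linarith+
  finally have "norm (z - l) \<le> 2 * N"
    by simp
  moreover have "l \<in> \<Lambda>"
    unfolding l_def by (intro multiples int_coords_in_eisenstein)
  ultimately show ?thesis by blast
qed

text \<open>A continuous function whose conjugate takes values in a discrete group is locally
  constant. Two holomorphic lifts of the same map therefore differ locally by a constant.\<close>

lemma deriv_eq_if_diff_in_lattice: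
  assumes "open S" "u \<in> S" "g holomorphic_on S" "h holomorphic_on S"
    and cnj_diff: "\<And>w. w \<in> S \<Longrightarrow> cnj (g w) - cnj (h w) \<in> \<Lambda>"
  shows "deriv g u = deriv h u"
proof -
  define k where "k w = g w - h w" for w
  have "continuous_on S k"
    unfolding k_def using assms(3,4)
    by (intro continuous_intros holomorphic_on_imp_continuous_on)
  then have "isCont k u"
    using assms(1,2) continuous_on_eq_continuous_at by blast
  then have "eventually (\<lambda>w. dist (k w) (k u) < 1) (nhds u)"
    unfolding continuous_at_eps_delta eventually_nhds_metric
    by (metis zero_less_one)
  moreover have "eventually (\<lambda>w. w \<in> S) (nhds u)"
    using assms(1,2) by (rule eventually_nhds_in_open)
  ultimately have "eventually (\<lambda>w. g w = h w + k u) (nhds u)"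
  proof eventually_elim
    case (elim w)
    have "cnj (k w - k u) = (cnj (g w) - cnj (h w)) - (cnj (g u) - cnj (h u))"
      by (simp add: k_def)
    also have "\<dots> \<in> \<Lambda>"
      using elim(2) assms(2) diff[OF cnj_diff cnj_diff] by blast
    finally have "cnj (k w - k u) \<in> \<Lambda>" .
    moreover have "norm (cnj (k w - k u)) < 1"
      using elim(1) by (simp only: dist_norm complex_mod_cnj)
    ultimately have "cnj (k w - k u) = 0"
      using norm_ge_1 by fastforce
    then have "k w - k u = 0"
      by (simp only: complex_cnj_zero_iff)
    then show ?case
      by (simp add: k_def algebra_simps)
  qed
  then have "deriv g u = deriv (\<lambda>w. h w + k u) u"
    by (rule deriv_cong_ev) simp
  also have "\<dots> = deriv h u"
    using assms(1,2,4) by (simp add: holomorphic_on_imp_differentiable_at)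
  finally show ?thesis .
qed

lemma anticonformal_affine:
  assumes "anticonformal \<Lambda> f"
  shows "\<exists>\<alpha> \<beta>. \<forall>u. f (proj \<Lambda> u) = proj \<Lambda> (\<alpha> * cnj u + \<beta>)"
proof -
  obtain r g where r: "\<And>z. r z > 0" and hol: "\<And>z. g z holomorphic_on ball z (r z)"
    and lift: "\<And>z u. u \<in> ball z (r z) \<Longrightarrow> f (proj \<Lambda> u) = proj \<Lambda> (cnj (g z u))"
    using assms unfolding anticonformal_def by metis
  \<comment> \<open>The local lifts need not agree where they overlap, but their derivatives do, so
    \<open>h\<close> is a single function on the whole plane.\<close>
  define h where "h u = deriv (g u) u" for u
  have h_eq: "h u = deriv (g z) u" if "u \<in> ball z (r z)" for z u
    unfolding h_def
  proof (rule deriv_eq_if_diff_in_lattice[of "ball z (r z) \<inter> ball u (r u)"])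
    show "cnj (g u w) - cnj (g z w) \<in> \<Lambda>" if "w \<in> ball z (r z) \<inter> ball u (r u)" for w
      using lift[of w u] lift[of w z] that by (simp flip: proj_eq_iff)
  qed (use that r hol in \<open>auto intro: holomorphic_on_subset\<close>)
  have "h holomorphic_on ball z (r z)" for z
    by (rule holomorphic_transform[OF holomorphic_deriv[OF hol[of z]]]) (simp_all add: h_eq)
  then have "h field_differentiable at z" for z
    using r[of z] by (metis centre_in_ball holomorphic_on_imp_differentiable_at open_ball)
  then have h_hol: "h holomorphic_on UNIV"
    by (simp add: holomorphic_on_def field_differentiable_at_within)
  have periodic: "h (u + l) = h u" if l: "l \<in> \<Lambda>" for u l
  proof -
    \<comment> \<open>On this ball both the lift around \<open>u\<close> and the translated lift
      around \<open>u + l\<close> are available. They lift the same values of \<open>f\<close>,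
      hence have equal derivatives at \<open>u\<close>.\<close>
    define S where "S = ball u (min (r u) (r (u + l)))"
    have shift: "w + l \<in> ball (u + l) (r (u + l))" if "w \<in> S" for w
      using that by (simp add: S_def dist_norm)
    have uS: "u \<in> S"
      using r by (simp add: S_def)
    have diffble: "g (u + l) field_differentiable at (u + l)"
      using hol r by (metis centre_in_ball holomorphic_on_imp_differentiable_at open_ball)
    have "deriv (\<lambda>w. g (u + l) (w + l)) u = deriv (g u) u"
    proof (rule deriv_eq_if_diff_in_lattice[of S])
      have "(g (u + l) \<circ> (\<lambda>w. w + l)) holomorphic_on S"
        using shift by (intro holomorphic_on_compose_gen[OF _ hol]) (auto intro!: holomorphic_intros)
      then show "(\<lambda>w. g (u + l) (w + l)) holomorphic_on S"
        by (simp add: o_def)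
      show "g u holomorphic_on S"
        using hol by (rule holomorphic_on_subset) (auto simp: S_def)
      show "cnj (g (u + l) (w + l)) - cnj (g u w) \<in> \<Lambda>" if "w \<in> S" for w
      proof -
        have "proj \<Lambda> (w + l) = proj \<Lambda> w"
          using l by (simp add: proj_eq_iff)
        then show ?thesis
          using lift[OF shift[OF that]] lift[of w u] that by (simp add: S_def flip: proj_eq_iff)
      qed
    qed (use uS in \<open>simp_all add: S_def\<close>)
    moreover have "deriv (g (u + l) \<circ> (\<lambda>w. w + l)) u = deriv (g (u + l)) (u + l)"
      using diffble by (subst deriv_chain) (auto intro!: derivative_intros)
    ultimately show ?thesis
      by (simp add: h_def o_def)
  qed
  have "bounded (range h)"
  proof -
    have "compact (h ` cball 0 (2 * N))"
      using holomorphic_on_subset[OF h_hol]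
      by (intro compact_continuous_image holomorphic_on_imp_continuous_on) auto
    \<comment> \<open>By periodicity all values of \<open>h\<close> are taken on a compact disc,
      which provides the bound for Liouville's theorem.\<close>
    moreover have "range h \<subseteq> h ` cball 0 (2 * N)"
    proof clarify
      fix z
      obtain l where l: "l \<in> \<Lambda>" "norm (z - l) \<le> 2 * N"
        using bounded_representative by blast
      then have "h z = h (z - l)"
        using periodic[of l "z - l"] by simp
      then show "h z \<in> h ` cball 0 (2 * N)"
        using l(2) by auto
    qed
    ultimately show ?thesis
      using bounded_subset compact_imp_bounded by blast
  qed
  then obtain a where a: "\<And>z. h z = a"
    using Liouville_theorem[OF h_hol] by (auto simp: constant_on_def)
  have "\<exists>c. \<forall>u\<in>ball z (r z). g z u = a * u + c" for z
  proof -
    have "\<exists>c. \<forall>u\<in>ball z (r z). g z u - a * u = c"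
    proof (rule has_field_derivative_zero_constant)
      show "((\<lambda>u. g z u - a * u) has_field_derivative 0) (at u within ball z (r z))"
        if u: "u \<in> ball z (r z)" for u
      proof -
        have "(g z has_field_derivative a) (at u)"
          using holomorphic_derivI[OF hol open_ball u] unfolding h_eq[OF u, symmetric] a .
        from DERIV_diff[OF this DERIV_cmult_Id, of a] show ?thesis
          by (simp add: has_field_derivative_at_within)
      qed
    qed simp
    then obtain c where "\<forall>u\<in>ball z (r z). g z u - a * u = c"
      by blast
    then have "\<forall>u\<in>ball z (r z). g z u = a * u + c"
      by (simp add: algebra_simps)
    then show ?thesis ..
  qed
  then obtain c where "\<And>z u. u \<in> ball z (r z) \<Longrightarrow> g z u = a * u + c z"
    by metis
  then have local_affine: "f (proj \<Lambda> u) = proj \<Lambda> (cnj a * cnj u + cnj (c z))"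
    if "u \<in> ball z (r z)" for z u
    using lift[OF that] that by simp
  \<comment> \<open>The constants \<open>c z\<close> may still vary by lattice elements. Whether the
    formula centred at \<open>0\<close> holds is decided uniformly on each ball, so \<open>S\<close>
    is open and closed, and the plane is connected.\<close>
  define S where "S = {u. f (proj \<Lambda> u) = proj \<Lambda> (cnj a * cnj u + cnj (c 0))}"
  have S_iff: "u \<in> S \<longleftrightarrow> cnj (c z) - cnj (c 0) \<in> \<Lambda>" if "u \<in> ball z (r z)" for u z
    using local_affine[OF that] by (simp add: S_def proj_eq_iff)
  have dichotomy: "ball z (r z) \<subseteq> S \<or> ball z (r z) \<subseteq> - S" for z
    using S_iff[of _ z] by blast
  have "open S"
    unfolding open_contains_ball using dichotomy r by (metis centre_in_ball ComplD subset_iff)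
  moreover have "open (- S)"
    unfolding open_contains_ball using dichotomy r by (metis centre_in_ball ComplD subset_iff)
  moreover have "0 \<in> S"
    using local_affine[of 0 0] r by (simp add: S_def)
  ultimately have "S = UNIV"
    using clopen[of S] by (auto simp: closed_def)
  then show ?thesis
    unfolding S_def by blast
qed

end

section \<open>Reflections and their mirrors\<close>

text \<open>The fixed point \<open>u\<close> rules out glide reflections. In the coordinate
  \<open>cnj \<rho> * u\<close> the map becomes
  \<open>w \<mapsto> \<epsilon> * cnj w + cnj \<rho> * \<beta>\<close>, whose axis is horizontal or
  vertical according to the sign \<epsilon>.\<close>

lemma reflection_axis:
  assumes "\<alpha> \<in> eisenstein" "norm \<alpha> = 1" "\<beta> \<in> eisenstein" and u: "\<alpha> * cnj u + \<beta> = u"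
  shows "\<exists>v\<in>eisenstein. \<exists>\<rho>\<in>cube_roots. \<exists>d\<in>{1, 1 + 2 * omega}.
    {u. \<alpha> * cnj u + \<beta> = u} = range (\<lambda>t. v + of_real t * (\<rho> * d))"
proof -
  obtain \<rho> \<epsilon> where \<rho>: "\<rho> \<in> cube_roots" and \<epsilon>: "\<epsilon> = 1 \<or> \<epsilon> = - 1" and \<alpha>: "\<alpha> = \<epsilon> * (\<rho> * \<rho>)"
    using eisenstein_unit_cube_root[OF assms(1,2)]
    by (metis mult_1 mult_minus1)
  have \<rho>1: "cnj \<rho> * \<rho> = 1" "\<rho> * cnj \<rho> = 1"
    using cube_roots_mult_cnj[OF \<rho>] by (simp_all add: mult.commute)
  have "cnj \<rho> * \<beta> \<in> eisenstein"
    using \<rho> assms(3) by (simp add: eisenstein_mult eisenstein_cnj cube_roots_eisenstein)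
  then obtain m n where mn: "cnj \<rho> * \<beta> = of_int m + of_int n * omega"
    unfolding eisenstein_def by blast
  have axis_iff: "\<alpha> * cnj u + \<beta> = u \<longleftrightarrow>
      \<epsilon> * cnj (cnj \<rho> * u) + (of_int m + of_int n * omega) = cnj \<rho> * u" for u
  proof -
    have "cnj \<rho> * (\<alpha> * cnj u + \<beta>) = \<epsilon> * (cnj \<rho> * \<rho>) * (\<rho> * cnj u) + cnj \<rho> * \<beta>"
      by (simp add: \<alpha> algebra_simps)
    also have "\<dots> = \<epsilon> * cnj (cnj \<rho> * u) + (of_int m + of_int n * omega)"
      by (simp add: \<rho>1 mn)
    finally show ?thesis
      using \<rho>1 by (metis mult_cancel_left mult_zero_left zero_neq_one)
  qed
  have axis: "{u. \<alpha> * cnj u + \<beta> = u} = range (\<lambda>t. \<rho> * v + of_real t * (\<rho> * d))"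
    if v: "\<And>w. \<epsilon> * cnj w + (of_int m + of_int n * omega) = w \<longleftrightarrow> (\<exists>t. w = v + of_real t * d)" for v d
  proof -
    have "cnj \<rho> * u = v + of_real t * d \<longleftrightarrow> u = \<rho> * v + of_real t * (\<rho> * d)" for u t
    proof -
      have "cnj \<rho> * u = v + of_real t * d \<longleftrightarrow> \<rho> * (cnj \<rho> * u) = \<rho> * (v + of_real t * d)"
        using \<rho>1 by (metis mult_cancel_left mult_zero_left zero_neq_one)
      also have "\<rho> * (cnj \<rho> * u) = u"
        using \<rho>1 by (simp flip: mult.assoc)
      finally show ?thesis
        by (simp add: algebra_simps)
    qed
    then show ?thesis
      unfolding axis_iff v by auto
  qed
  have u': "\<epsilon> * cnj (cnj \<rho> * u) + (of_int m + of_int n * omega) = cnj \<rho> * u"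
    using u axis_iff by blast
  show ?thesis
    using \<epsilon>
  proof
    assume \<epsilon>: "\<epsilon> = 1"
    \<comment> \<open>A fixed point forces the translation part to be perpendicular to the axis, so
      \<open>n = 2 * m\<close>. The axis is then the horizontal line through the vertex
      \<open>m * omega\<close>.\<close>
    have "of_int m - of_int n / 2 = (0::real)"
      using arg_cong[OF u', of Re] unfolding \<epsilon> by simp
    then have n: "of_int n = (2 * of_int m :: real)"
      by simp
    have "\<epsilon> * cnj w + (of_int m + of_int n * omega) = w \<longleftrightarrow>
        (\<exists>t. w = of_int m * omega + of_real t * 1)" for w
    proof
      assume "\<epsilon> * cnj w + (of_int m + of_int n * omega) = w"
      then have "Im w = of_int m * sqrt 3 / 2"
        using n by (simp add: complex_eq_iff \<epsilon>)
      then have "w = of_int m * omega + of_real (Re w + of_int m / 2) * 1"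
        by (simp add: complex_eq_iff)
      then show "\<exists>t. w = of_int m * omega + of_real t * 1" ..
    qed (use n in \<open>auto simp: complex_eq_iff \<epsilon>\<close>)
    then have "{u. \<alpha> * cnj u + \<beta> = u} = range (\<lambda>t. \<rho> * (of_int m * omega) + of_real t * (\<rho> * 1))"
      by (rule axis)
    moreover have "\<rho> * (of_int m * omega) \<in> eisenstein"
      using \<rho> by (simp add: eisenstein_mult cube_roots_eisenstein)
    ultimately show ?thesis
      using \<rho> by blast
  next
    assume \<epsilon>: "\<epsilon> = - 1"
    \<comment> \<open>Here the translation part must be real. The axis is the vertical line with
      real part \<open>m / 2\<close>, which contains the vertex \<open>- m * omega\<close>; its
      direction \<open>1 + 2 * omega\<close> equals \<open>\<i> * sqrt 3\<close>.\<close>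
    have n: "n = 0"
      using arg_cong[OF u', of Im] unfolding \<epsilon> by simp
    have "\<epsilon> * cnj w + (of_int m + of_int n * omega) = w \<longleftrightarrow>
        (\<exists>t. w = - of_int m * omega + of_real t * (1 + 2 * omega))" for w
    proof
      assume "\<epsilon> * cnj w + (of_int m + of_int n * omega) = w"
      then have "2 * Re w = of_int m"
        using n by (simp add: complex_eq_iff \<epsilon>)
      then have "w = - of_int m * omega
          + of_real ((Im w + of_int m * sqrt 3 / 2) / sqrt 3) * (1 + 2 * omega)"
        by (simp add: complex_eq_iff)
      then show "\<exists>t. w = - of_int m * omega + of_real t * (1 + 2 * omega)" ..
    qed (use n in \<open>auto simp: complex_eq_iff \<epsilon>\<close>)
    then have "{u. \<alpha> * cnj u + \<beta> = u}
        = range (\<lambda>t. \<rho> * (- of_int m * omega) + of_real t * (\<rho> * (1 + 2 * omega)))"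
      by (rule axis)
    moreover have "\<rho> * (- of_int m * omega) \<in> eisenstein"
      using \<rho> by (simp add: eisenstein_mult cube_roots_eisenstein eisenstein_uminus)
    ultimately show ?thesis
      using \<rho> by blast
  qed
qed

section \<open>From reflections of the torus to axes in the plane\<close>

context eisenstein_lattice
begin

lemma reflection_affine:
  assumes f: "is_reflection \<Lambda> f"
  obtains \<alpha> \<beta> where "\<alpha> \<in> eisenstein" "norm \<alpha> = 1" "\<beta> \<in> eisenstein"
    and "\<And>u. f (proj \<Lambda> u) = proj \<Lambda> (\<alpha> * cnj u + \<beta>)"
    and "\<And>l. l \<in> \<Lambda> \<Longrightarrow> \<alpha> * cnj l \<in> \<Lambda>"
proof -
  have "anticonformal \<Lambda> f"
    using f by (simp add: is_reflection_def)
  then obtain \<alpha> \<beta> where lift: "\<And>u. f (proj \<Lambda> u) = proj \<Lambda> (\<alpha> * cnj u + \<beta>)"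
    using anticonformal_affine[of f] by metis
  have f_vertex: "f ` geo_points \<Lambda> Vertex = geo_points \<Lambda> Vertex"
    and f_invol: "\<And>p. p \<in> torus \<Lambda> \<Longrightarrow> f (f p) = p"
    using f by (simp_all add: is_reflection_def preserves_map_def)
  have vertex: "\<alpha> * cnj x + \<beta> \<in> eisenstein" if "x \<in> eisenstein" for x
  proof -
    have "proj \<Lambda> x \<in> geo_points \<Lambda> Vertex"
      using that by (simp add: proj_in_geo_points_iff)
    then have "f (proj \<Lambda> x) \<in> geo_points \<Lambda> Vertex"
      using f_vertex by blast
    then show ?thesis
      by (simp add: lift proj_in_geo_points_iff)
  qed
  have \<beta>: "\<beta> \<in> eisenstein"
    using vertex[of 0] by simp
  have \<alpha>: "\<alpha> \<in> eisenstein"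
    using eisenstein_diff[OF vertex[of 1] \<beta>] by simp
  have lattice: "\<alpha> * cnj l \<in> \<Lambda>" if "l \<in> \<Lambda>" for l
  proof -
    have "proj \<Lambda> l = proj \<Lambda> 0"
      using that by (simp add: proj_eq_iff)
    then have "f (proj \<Lambda> l) = f (proj \<Lambda> 0)"
      by simp
    then show ?thesis
      unfolding lift proj_eq_iff by simp
  qed
  have invol: "\<alpha> * cnj (\<alpha> * cnj u + \<beta>) + \<beta> - u \<in> \<Lambda>" for u
  proof -
    have "f (f (proj \<Lambda> u)) = proj \<Lambda> u"
      by (simp add: f_invol torus_def)
    then show ?thesis
      unfolding lift proj_eq_iff .
  qed
  \<comment> \<open>This is the linear coefficient of the lifted square of \<open>f\<close> minus
    the identity. All its multiples lie in the discrete set \<Lambda>; if it were nonzero, one of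
    them would be \<open>1 / 2\<close>, of norm below \<open>1\<close>.\<close>
  define k where "k = \<alpha> * cnj \<alpha> - 1"
  have k_mult: "k * u \<in> \<Lambda>" for u
    using diff[OF invol[of u] invol[of 0]] by (simp add: k_def algebra_simps)
  have "k = 0"
  proof (rule ccontr)
    assume "k \<noteq> 0"
    then have "1 / 2 \<in> \<Lambda>"
      using k_mult[of "1 / 2 / k"] by simp
    from norm_ge_1[OF this] show False
      by (simp add: norm_divide)
  qed
  then have "of_real ((norm \<alpha>)\<^sup>2) = (1 :: complex)"
    unfolding k_def complex_norm_square by simp
  then have "(norm \<alpha>)\<^sup>2 = 1"
    by (metis of_real_eq_1_iff)
  then have "norm \<alpha> = 1"
    using norm_ge_zero[of \<alpha>] by (auto simp: power2_eq_1_iff)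
  then show ?thesis
    using that \<alpha> \<beta> lift lattice by blast
qed

text \<open>On the fixed set the displacement \<open>\<alpha> * cnj u + \<beta> - u\<close> takes values in the discrete set
  \<open>\<Lambda>\<close>, so it cuts the fixed set into relatively open pieces.\<close>

lemma mirror_eq_axis_image:
  assumes lift: "\<And>u. f (proj \<Lambda> u) = proj \<Lambda> (\<alpha> * cnj u + \<beta>)"
    and lattice: "\<And>l. l \<in> \<Lambda> \<Longrightarrow> \<alpha> * cnj l \<in> \<Lambda>"
    and axis: "{u. \<alpha> * cnj u + \<beta> = u} = range (\<lambda>t. v + of_real t * d)"
    and C: "C \<in> mirrors \<Lambda> f" and p: "\<alpha> * cnj p + \<beta> = p" "proj \<Lambda> p \<in> C"
  shows "C = proj \<Lambda> ` range (\<lambda>t. v + of_real t * d)"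
proof -
  define \<psi> where "\<psi> u = \<alpha> * cnj u + \<beta> - u" for u
  \<comment> \<open>\<open>B\<close> consists of the changes of \<psi> under lattice translations.
    It is a subgroup of \<Lambda>, and the class of \<open>\<psi> u\<close> modulo \<open>B\<close>
    depends only on the point of the torus.\<close>
  define B where "B = (\<lambda>l. \<alpha> * cnj l - l) ` \<Lambda>"
  define X where "X = subtopology (torus_topology \<Lambda>) {p \<in> torus \<Lambda>. f p = p}"
  have \<psi>_add: "\<psi> (u + l) = \<psi> u + (\<alpha> * cnj l - l)" for u l
    by (simp add: \<psi>_def algebra_simps)
  have B_I: "\<alpha> * cnj l - l \<in> B" if "l \<in> \<Lambda>" for l
    using that by (simp only: B_def image_eqI)
  have B_subset: "B \<subseteq> \<Lambda>"
    using lattice diff by (auto simp: B_def)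
  have B_add: "x + y \<in> B" if "x \<in> B" "y \<in> B" for x y
  proof -
    obtain l l' where l: "l \<in> \<Lambda>" "l' \<in> \<Lambda>" "x = \<alpha> * cnj l - l" "y = \<alpha> * cnj l' - l'"
      using \<open>x \<in> B\<close> \<open>y \<in> B\<close> by (auto simp: B_def)
    have "x + y = \<alpha> * cnj (l + l') - (l + l')"
      unfolding l by (simp add: algebra_simps)
    then show ?thesis
      using l add unfolding B_def by blast
  qed
  have B_uminus: "- x \<in> B" if x: "x \<in> B" for x
  proof -
    obtain l where l: "l \<in> \<Lambda>" "x = \<alpha> * cnj l - l"
      using x by (auto simp: B_def)
    then have "- x = \<alpha> * cnj (- l) - (- l)"
      by simp
    then show ?thesis
      using l uminus unfolding B_def by blast
  qed
  have fixed: "{p \<in> torus \<Lambda>. f p = p} = proj \<Lambda> ` {u. \<psi> u \<in> \<Lambda>}"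
    unfolding \<psi>_def proj_eq_iff[symmetric] lift[symmetric] torus_def by blast
  have topspace_X: "topspace X = proj \<Lambda> ` {u. \<psi> u \<in> \<Lambda>}"
    unfolding X_def topspace_subtopology topspace_torus_topology fixed by (auto simp: torus_def)
  have open_pieces: "openin X (proj \<Lambda> ` {u. \<psi> u \<in> A})"
    if A: "A \<subseteq> \<Lambda>" "\<And>a x. a \<in> A \<Longrightarrow> x \<in> B \<Longrightarrow> a + x \<in> A" for A
  proof -
    \<comment> \<open>Thickening \<open>A\<close> by \<open>1\<close> makes the set open. On the
      fixed set nothing is gained, because distinct lattice elements are at distance at least
      \<open>1\<close>; and \<open>U\<close> is a union of cosets because \<open>A\<close> is stable
      under adding \<open>B\<close>.\<close>
    define U where "U = {u. \<exists>a\<in>A. dist (\<psi> u) a < 1}"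
    have "U = (\<Union>a\<in>A. \<psi> -` ball a 1)"
      by (auto simp: U_def dist_commute)
    moreover have "open (\<psi> -` ball a 1)" for a
      unfolding \<psi>_def by (intro open_vimage continuous_intros) simp
    ultimately have open_U: "open U"
      by auto
    have saturated: "proj \<Lambda> -` (proj \<Lambda> ` U) = U"
    proof (intro equalityI subsetI)
      fix w assume "w \<in> proj \<Lambda> -` (proj \<Lambda> ` U)"
      then obtain u where u: "u \<in> U" "w - u \<in> \<Lambda>"
        by (auto simp: proj_eq_iff)
      then obtain a where a: "a \<in> A" "dist (\<psi> u) a < 1"
        by (auto simp: U_def)
      define x where "x = \<alpha> * cnj (w - u) - (w - u)"
      have "\<psi> w = \<psi> u + x"
        using \<psi>_add[of u "w - u"] by (simp add: x_def)
      then have "dist (\<psi> w) (a + x) < 1"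
        using a(2) by (simp add: dist_norm)
      moreover have "a + x \<in> A"
        unfolding x_def using a(1) u(2) by (intro A(2) B_I)
      ultimately show "w \<in> U"
        by (auto simp: U_def)
    qed auto
    have "openin (torus_topology \<Lambda>) (proj \<Lambda> ` U)"
      using open_U by (auto simp: openin_torus_topology saturated torus_def)
    moreover have "proj \<Lambda> ` {u. \<psi> u \<in> A} = proj \<Lambda> ` U \<inter> {p \<in> torus \<Lambda>. f p = p}"
    proof (intro equalityI subsetI)
      fix q assume "q \<in> proj \<Lambda> ` {u. \<psi> u \<in> A}"
      then obtain u where "q = proj \<Lambda> u" "\<psi> u \<in> A"
        by auto
      moreover from this have "u \<in> U"
        by (auto simp: U_def intro!: bexI[of _ "\<psi> u"])
      ultimately show "q \<in> proj \<Lambda> ` U \<inter> {p \<in> torus \<Lambda>. f p = p}"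
        using A(1) unfolding fixed by blast
    next
      fix q assume q: "q \<in> proj \<Lambda> ` U \<inter> {p \<in> torus \<Lambda>. f p = p}"
      then obtain u where u: "q = proj \<Lambda> u" "\<psi> u \<in> \<Lambda>"
        unfolding fixed by blast
      then have "u \<in> U"
        using q saturated by blast
      then obtain a where a: "a \<in> A" "dist (\<psi> u) a < 1"
        by (auto simp: U_def)
      then have "\<psi> u - a = 0"
        using norm_ge_1[OF diff[OF u(2)], of a] A(1) by (force simp: dist_norm)
      then show "q \<in> proj \<Lambda> ` {u. \<psi> u \<in> A}"
        using u a by auto
    qed
    ultimately show ?thesis
      unfolding X_def openin_subtopology by blast
  qed
  let ?L = "proj \<Lambda> ` range (\<lambda>t. v + of_real t * d)"
  \<comment> \<open>The axis is the zero set of \<psi>, and its lattice translates are exactly the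
    points where \<psi> takes a value in \<open>B\<close>.\<close>
  have L_eq: "?L = proj \<Lambda> ` {u. \<psi> u \<in> B}"
  proof (intro equalityI subsetI)
    fix q assume "q \<in> ?L"
    then obtain u where q: "q = proj \<Lambda> u" and "\<alpha> * cnj u + \<beta> = u"
      unfolding axis[symmetric] by blast
    then have "\<psi> u = 0"
      by (simp add: \<psi>_def)
    moreover have "0 \<in> B"
      using B_I[OF zero] by simp
    ultimately show "q \<in> proj \<Lambda> ` {u. \<psi> u \<in> B}"
      unfolding q by (intro imageI CollectI) simp
  next
    fix q assume "q \<in> proj \<Lambda> ` {u. \<psi> u \<in> B}"
    then obtain u l where u: "q = proj \<Lambda> u" "l \<in> \<Lambda>" "\<psi> u = \<alpha> * cnj l - l"
      unfolding B_def by blast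
    then have "\<psi> (u - l) = 0"
      using \<psi>_add[of "u - l" l] by simp
    moreover have "q = proj \<Lambda> (u - l)"
      using u by (simp add: proj_eq_iff)
    ultimately show "q \<in> ?L"
      unfolding axis[symmetric] \<psi>_def by simp
  qed
  have "openin X ?L"
    unfolding L_eq using B_subset B_add by (rule open_pieces)
  moreover have "closedin X ?L"
  proof -
    have "topspace X - ?L = proj \<Lambda> ` {u. \<psi> u \<in> \<Lambda> - B}"
    proof (intro equalityI subsetI)
      fix q assume "q \<in> proj \<Lambda> ` {u. \<psi> u \<in> \<Lambda> - B}"
      then obtain u where u: "q = proj \<Lambda> u" "\<psi> u \<in> \<Lambda>" "\<psi> u \<notin> B"
        by auto
      have "q \<notin> proj \<Lambda> ` {u. \<psi> u \<in> B}"
      proof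
        assume "q \<in> proj \<Lambda> ` {u. \<psi> u \<in> B}"
        then obtain w where w: "u - w \<in> \<Lambda>" "\<psi> w \<in> B"
          using u(1) by (auto simp: proj_eq_iff)
        have "\<psi> u = \<psi> w + (\<alpha> * cnj (u - w) - (u - w))"
          using \<psi>_add[of w "u - w"] by simp
        also have "\<dots> \<in> B"
          using w by (intro B_add B_I)
        finally show False
          using u(3) by blast
      qed
      then show "q \<in> topspace X - ?L"
        unfolding L_eq topspace_X using u by blast
    qed (auto simp: L_eq topspace_X)
    \<comment> \<open>The complement is again such a piece, so the image of the axis is open and
      closed in the fixed set. Being connected as well, it is a whole component.\<close>
    moreover have "openin X (proj \<Lambda> ` {u. \<psi> u \<in> \<Lambda> - B})"
    proof (rule open_pieces)
      show "a + x \<in> \<Lambda> - B" if "a \<in> \<Lambda> - B" "x \<in> B" for a x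
        using that B_subset add[of a x] B_add[OF _ B_uminus, of "a + x" x] by auto
    qed auto
    ultimately show ?thesis
      using open_pieces[OF B_subset B_add] B_subset
      by (auto simp: closedin_def L_eq topspace_X)
  qed
  moreover have C': "C \<in> connected_components_of X"
    using C by (simp add: mirrors_def X_def)
  then have "connectedin X C"
    by (rule connectedin_connected_components_of)
  moreover have "proj \<Lambda> p \<in> ?L"
    using p(1) unfolding axis[symmetric] by auto
  ultimately have "C \<subseteq> ?L"
    using connectedin_clopen_cases[of X C ?L] p(2) unfolding disjnt_iff by blast
  moreover have "?L \<subseteq> C"
  proof -
    have "connected (range (\<lambda>t. v + of_real t * d))"
      by (intro connected_continuous_image continuous_intros) simp
    then have "connectedin (torus_topology \<Lambda>) ?L"
      by (intro connectedin_continuous_map_image[OF quotient_imp_continuous_map[OF quotient_map_proj]])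
        simp
    moreover have "?L \<subseteq> {p \<in> torus \<Lambda>. f p = p}"
      unfolding L_eq fixed using B_subset by blast
    ultimately have "connectedin X ?L"
      by (simp add: X_def connectedin_subtopology)
    then show ?thesis
      using connected_components_of_maximal[OF C'] \<open>proj \<Lambda> p \<in> ?L\<close> p(2)
      unfolding disjnt_iff by blast
  qed
  ultimately show ?thesis ..
qed

lemma mirror_is_line:
  assumes f: "is_reflection \<Lambda> f" and C: "C \<in> mirrors \<Lambda> f"
  shows "\<exists>v\<in>eisenstein. \<exists>\<rho>\<in>cube_roots. \<exists>d\<in>{1, 1 + 2 * omega}.
    C = proj \<Lambda> ` range (\<lambda>t. v + of_real t * (\<rho> * d))"
proof -
  obtain \<alpha> \<beta> where \<alpha>: "\<alpha> \<in> eisenstein" "norm \<alpha> = 1" and \<beta>: "\<beta> \<in> eisenstein"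
    and lift: "\<And>u. f (proj \<Lambda> u) = proj \<Lambda> (\<alpha> * cnj u + \<beta>)"
    and lattice: "\<And>l. l \<in> \<Lambda> \<Longrightarrow> \<alpha> * cnj l \<in> \<Lambda>"
    using reflection_affine[OF f] by blast
  have "C \<noteq> {}" "C \<subseteq> {p \<in> torus \<Lambda>. f p = p}"
    using C nonempty_connected_components_of connected_components_of_subset
    unfolding mirrors_def by (blast, fastforce)
  then obtain u where u: "proj \<Lambda> u \<in> C" "f (proj \<Lambda> u) = proj \<Lambda> u"
    unfolding torus_def by blast
  \<comment> \<open>The lift is adjusted by a lattice element so that \<open>u\<close> is fixed in
    the plane, not merely modulo \<Lambda>. The adjustment depends on the chosen mirror.\<close>
  define \<beta>' where "\<beta>' = u - \<alpha> * cnj u"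
  have "\<beta> - \<beta>' \<in> \<Lambda>"
    using u(2) by (simp add: lift proj_eq_iff \<beta>'_def algebra_simps)
  then have lift': "\<And>u. f (proj \<Lambda> u) = proj \<Lambda> (\<alpha> * cnj u + \<beta>')" and \<beta>': "\<beta>' \<in> eisenstein"
    using eisenstein_diff[OF \<beta>, of "\<beta> - \<beta>'"] subset by (auto simp: lift proj_eq_iff)
  have u': "\<alpha> * cnj u + \<beta>' = u"
    by (simp add: \<beta>'_def)
  show ?thesis
    using reflection_axis[OF \<alpha> \<beta>' u'] mirror_eq_axis_image[OF lift' lattice _ C u' u(1)]
    by (meson)
qed

end

section \<open>Reading the pattern along a closed line\<close>

text \<open>The parameter interval is cut into \<open>K\<close> equal steps, each carrying the
  offsets \<open>os\<close>; the times of the first \<open>k\<close> steps are listed. The scale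
  \<open>K\<close> is kept apart from \<open>k\<close> to allow induction on
  \<open>k\<close>.\<close>

definition repeated_times :: "real list \<Rightarrow> nat \<Rightarrow> nat \<Rightarrow> real list" where
  "repeated_times os K k = concat (map (\<lambda>j. map (\<lambda>x. (real j + x) / real K) os) [0..<k])"

lemma repeated_times_0: "repeated_times os K 0 = []"
  and repeated_times_Suc: "repeated_times os K (Suc k) =
    repeated_times os K k @ map (\<lambda>x. (real k + x) / real K) os"
  by (simp_all add: repeated_times_def)

lemma set_repeated_times:
  "set (repeated_times os K k) = {(real j + x) / real K | j x. j < k \<and> x \<in> set os}"
  by (fastforce simp: repeated_times_def)

lemma sorted_repeated_times:
  assumes "K > 0" "sorted_wrt (<) os" "set os \<subseteq> {0..<1}"
  shows "sorted_wrt (<) (repeated_times os K k)"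
proof (induction k)
  case (Suc k)
  have "s < t" if s: "s \<in> set (repeated_times os K k)"
    and t: "t \<in> set (map (\<lambda>x. (real k + x) / real K) os)" for s t
  proof -
    obtain j x where "s = (real j + x) / real K" "j < k" "x \<in> set os"
      using s by (auto simp: set_repeated_times)
    moreover obtain y where "t = (real k + y) / real K" "y \<in> set os"
      using t by auto
    moreover have "x < 1" "0 \<le> y"
      using assms(3) calculation by auto
    ultimately show ?thesis
      using assms(1) by (simp add: divide_strict_right_mono)
  qed
  moreover have "sorted_wrt (<) (map (\<lambda>x. (real k + x) / real K) os)"
    using assms(1,2) by (auto simp: sorted_wrt_map divide_strict_right_mono elim!: sorted_wrt_mono_rel[rotated])
  ultimately show ?case
    using Suc by (auto simp: repeated_times_Suc sorted_wrt_append)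
qed (simp add: repeated_times_0)

lemma list_all2_repeated_times:
  assumes "\<And>j. list_all2 P (map (\<lambda>x. (real j + x) / real K) os) w"
  shows "list_all2 P (repeated_times os K k) (word_power w k)"
proof (induction k)
  case (Suc k)
  \<comment> \<open>\<open>replicate\<close> adds its copy in front, whereas the list of times grows
    at the end.\<close>
  have "word_power w (Suc k) = word_power w k @ w"
    by (subst replicate_Suc, subst replicate_append_same[symmetric]) simp
  then show ?case
    using list_all2_appendI[OF Suc assms] by (simp only: repeated_times_Suc)
qed (simp add: repeated_times_0)

context eisenstein_lattice
begin

text \<open>The hypothesis \<open>period\<close> makes \<open>real K * d\<close> the primitive
  lattice vector along the line, so the image closes up after exactly \<open>K\<close> steps of
  length \<open>norm d\<close>. It then suffices to inspect one step starting at a vertex.\<close>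

lemma reads_line:
  assumes v: "v \<in> eisenstein" and d: "d \<in> eisenstein" and K: "K > 0"
    and period: "\<And>t. of_real t * d \<in> \<Lambda> \<longleftrightarrow> (\<exists>k::int. t = real K * of_int k)"
    and sorted: "sorted_wrt (<) os"
    and os: "set os = {x \<in> {0..<1}. \<exists>s. of_real x * d \<in> plane_points s}"
    and w: "list_all2 (\<lambda>x s. of_real x * d \<in> plane_points s) os w"
  shows "reads \<Lambda> (proj \<Lambda> ` range (\<lambda>t. v + of_real t * d)) (word_power w K)"
proof -
  define \<gamma> where "\<gamma> t = proj \<Lambda> (v + of_real (real K * t) * d)" for t
  have \<gamma>_eq_iff: "\<gamma> s = \<gamma> t \<longleftrightarrow> (\<exists>k::int. s - t = of_int k)" for s t
  proof -
    have "\<gamma> s = \<gamma> t \<longleftrightarrow> of_real (real K * (s - t)) * d \<in> \<Lambda>"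
      by (simp add: \<gamma>_def proj_eq_iff algebra_simps)
    then show ?thesis
      unfolding period using K by simp
  qed
  have \<gamma>_geo: "\<gamma> t \<in> geo_points \<Lambda> s \<longleftrightarrow> of_real (real K * t) * d \<in> plane_points s" for t s
    unfolding \<gamma>_def proj_in_geo_points_iff by (rule plane_points_translate_iff[OF v])
  \<comment> \<open>Whole steps are translations by Eisenstein integers and so repeat the same kinds
    of points.\<close>
  have shift: "of_real (of_int j + x) * d \<in> plane_points s \<longleftrightarrow> of_real x * d \<in> plane_points s"
    for j :: int and x s
  proof -
    have "of_int j * d \<in> eisenstein"
      using d by (simp add: eisenstein_mult)
    from plane_points_translate_iff[OF this, of "of_real x * d" s] show ?thesis
      by (simp add: algebra_simps)
  qed
  have "simple_closed_param \<Lambda> (proj \<Lambda> ` range (\<lambda>t. v + of_real t * d)) \<gamma>"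
    unfolding simple_closed_param_def
  proof (intro conjI)
    have "continuous_on {0..1} (\<lambda>t. v + of_real (real K * t) * d)"
      by (intro continuous_intros)
    then have "continuous_map (top_of_set {0..1}) euclidean (\<lambda>t. v + of_real (real K * t) * d)"
      by simp
    from continuous_map_compose[OF this quotient_imp_continuous_map[OF quotient_map_proj]]
    show "pathin (torus_topology \<Lambda>) \<gamma>"
      by (simp add: pathin_def \<gamma>_def[abs_def] o_def)
    show "\<gamma> 0 = \<gamma> 1"
      unfolding \<gamma>_eq_iff by (rule exI[of _ "- 1"]) simp
    show "inj_on \<gamma> {0..<1}"
    proof (rule inj_onI)
      fix s t :: real assume st: "s \<in> {0..<1}" "t \<in> {0..<1}" "\<gamma> s = \<gamma> t"
      then obtain k :: int where k: "s - t = of_int k"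
        unfolding \<gamma>_eq_iff by blast
      have "of_int k < (1::real)" "of_int k > (- 1::real)"
        using st(1,2) unfolding k[symmetric] by auto
      then have "k = 0"
        by linarith
      then show "s = t"
        using k by simp
    qed
    show "\<gamma> ` {0..1} = proj \<Lambda> ` range (\<lambda>t. v + of_real t * d)"
    proof (intro equalityI subsetI)
      fix q assume "q \<in> proj \<Lambda> ` range (\<lambda>t. v + of_real t * d)"
      then obtain t where "q = proj \<Lambda> (v + of_real t * d)"
        by blast
      then have "q = \<gamma> (t / real K)"
        using K by (simp add: \<gamma>_def)
      also have "\<dots> = \<gamma> (frac (t / real K))"
        unfolding \<gamma>_eq_iff frac_def by auto
      finally show "q \<in> \<gamma> ` {0..1}"
        using frac_ge_0 frac_lt_1 by (metis atLeastAtMost_iff imageI less_imp_le)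
    next
      fix q assume "q \<in> \<gamma> ` {0..1}"
      then show "q \<in> proj \<Lambda> ` range (\<lambda>t. v + of_real t * d)"
        unfolding \<gamma>_def by blast
    qed
  qed
  moreover have "sorted_wrt (<) (repeated_times os K K)"
  proof (rule sorted_repeated_times[OF K sorted])
    show "set os \<subseteq> {0..<1}"
      unfolding os by blast
  qed
  moreover have "set (repeated_times os K K) = {t \<in> {0..<1}. \<exists>s. \<gamma> t \<in> geo_points \<Lambda> s}"
  proof (intro equalityI subsetI)
    fix t assume "t \<in> set (repeated_times os K K)"
    then obtain j x where j: "t = (real j + x) / real K" "j < K" "x \<in> set os"
      unfolding set_repeated_times by blast
    obtain s where x: "0 \<le> x" "x < 1" and s: "of_real x * d \<in> plane_points s"
      using j(3) unfolding os by (auto simp del: plane_points.simps)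
    have "real j + x < real K"
      using j(2) x by linarith
    then have "t \<in> {0..<1}"
      using x K unfolding j(1) by simp
    moreover have "real K * t = of_int (int j) + x"
      using j(1) K by simp
    then have "\<gamma> t \<in> geo_points \<Lambda> s"
      by (simp only: \<gamma>_geo shift s)
    ultimately show "t \<in> {t \<in> {0..<1}. \<exists>s. \<gamma> t \<in> geo_points \<Lambda> s}"
      by blast
  next
    fix t assume "t \<in> {t \<in> {0..<1}. \<exists>s. \<gamma> t \<in> geo_points \<Lambda> s}"
    then obtain s where t: "0 \<le> t" "t < 1" and s: "of_real (real K * t) * d \<in> plane_points s"
      unfolding \<gamma>_geo by auto
    \<comment> \<open>The floor is the number of the step, the fractional part the offset within
      it.\<close>
    define j x where "j = \<lfloor>real K * t\<rfloor>" and "x = frac (real K * t)"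
    have split: "real K * t = of_int j + x"
      by (simp add: j_def x_def frac_def)
    have "real K * t < real K"
      using t K by simp
    then have j: "0 \<le> j" "j < int K"
      using t unfolding j_def by (simp, linarith)
    have "x \<in> set os"
      using s frac_ge_0[of "real K * t"] frac_lt_1[of "real K * t"]
      unfolding os x_def[symmetric] unfolding split shift by auto
    moreover have "t = (real (nat j) + x) / real K"
      using split K j by (simp add: field_simps)
    ultimately show "t \<in> set (repeated_times os K K)"
      using j unfolding set_repeated_times by (auto intro!: exI[of _ "nat j"] exI[of _ x])
  qed
  moreover have "list_all2 (\<lambda>t s. \<gamma> t \<in> geo_points \<Lambda> s) (repeated_times os K K) (word_power w K)"
  proof (rule list_all2_repeated_times)
    fix j
    have "of_real (real K * ((real j + x) / real K)) * d \<in> plane_points s \<longleftrightarrow>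
        of_real x * d \<in> plane_points s" for x s
      using shift[of "int j" x s] K by simp
    then show "list_all2 (\<lambda>t s. \<gamma> t \<in> geo_points \<Lambda> s) (map (\<lambda>x. (real j + x) / real K) os) w"
      using w unfolding list_all2_map1 \<gamma>_geo by simp
  qed
  ultimately show ?thesis
    unfolding reads_def by blast
qed

end

section \<open>Minimality of the repeating blocks\<close>

lemma word_power_root_split:
  assumes "word_power u k = word_power l K" "K > 0" "length u < length l"
  obtains X Y where "u \<noteq> []" "u @ u @ X = l @ Y"
proof -
  obtain K' where K: "K = Suc K'"
    using assms(2) gr0_implies_Suc by blast
  \<comment> \<open>One copy of the shorter word \<open>u\<close> cannot fill the power, so there
    are at least two copies. The same word thus begins both with \<open>u @ u\<close> and with
    \<open>l\<close>.\<close>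
  have "length (word_power u k) \<ge> length l"
    unfolding assms(1) K by simp
  then have len: "length u < length (word_power u k)"
    using assms(3) by linarith
  then have "u \<noteq> []"
    by (auto simp: length_concat sum_list_replicate)
  have "k \<noteq> 0"
    using len by (intro notI) simp
  moreover have "k \<noteq> 1"
    using len by (intro notI) simp
  ultimately obtain k' where "k = Suc (Suc k')"
    by (metis One_nat_def not0_implies_Suc)
  with \<open>u \<noteq> []\<close> show ?thesis
    using that assms(1) K by simp
qed

lemma word_01_primitive:
  assumes "K > 0" "word_power u k = word_power [Vertex, Edge_Centre] K"
  shows "length [Vertex, Edge_Centre] \<le> length u"
proof (rule ccontr)
  assume "\<not> ?thesis"
  then have short: "length u < length [Vertex, Edge_Centre]"
    by (simp only: not_le)
  then obtain X Y where "u \<noteq> []" "u @ u @ X = [Vertex, Edge_Centre] @ Y"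
    using word_power_root_split[OF assms(2,1)] by blast
  moreover obtain a where "u = [a]"
    using short \<open>u \<noteq> []\<close> by (cases u) auto
  ultimately show False
    by auto
qed

lemma word_0212_primitive:
  assumes "K > 0" "word_power u k = word_power [Vertex, Face_Centre, Edge_Centre, Face_Centre] K"
  shows "length [Vertex, Face_Centre, Edge_Centre, Face_Centre] \<le> length u"
proof (rule ccontr)
  assume "\<not> ?thesis"
  then have short: "length u < length [Vertex, Face_Centre, Edge_Centre, Face_Centre]"
    by (simp only: not_le)
  then obtain X Y where "u \<noteq> []"
    and eq: "u @ u @ X = [Vertex, Face_Centre, Edge_Centre, Face_Centre] @ Y"
    using word_power_root_split[OF assms(2,1)] by blast
  have "length u \<noteq> 0" "length u < 4"
    using short \<open>u \<noteq> []\<close> by simp_all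
  \<comment> \<open>In each case the first letter of the second copy of \<open>u\<close> would be a
    \<open>Vertex\<close> at the second, third or fourth place of the block, where there is
    none.\<close>
  then have "length u = 1 \<or> length u = 2 \<or> length u = 3"
    by linarith
  then show False
    using eq by (auto simp: numeral_eq_Suc length_Suc_conv)
qed

section \<open>The two kinds of lines\<close>

lemma of_real_in_plane_points:
  "of_real t \<in> plane_points Vertex \<longleftrightarrow> (\<exists>m::int. t = of_int m)"
  "of_real t \<in> plane_points Edge_Centre \<longleftrightarrow> (\<exists>m::int. t = of_int m / 2 \<and> odd m)"
  "of_real t \<notin> plane_points Face_Centre"
proof -
  have split: "of_real t = of_real t + of_real 0 * omega"
    by simp
  show "of_real t \<in> plane_points Vertex \<longleftrightarrow> (\<exists>m::int. t = of_int m)"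
    by (subst split) (auto simp: real_coords_in_eisenstein_iff Ints_def simp del: of_real_0)
  show "of_real t \<in> plane_points Edge_Centre \<longleftrightarrow> (\<exists>m::int. t = of_int m / 2 \<and> odd m)"
    by (subst split, subst real_coords_in_edge_centres_iff) auto
  show "of_real t \<notin> plane_points Face_Centre"
    by (subst split, subst real_coords_in_face_centres_iff) auto
qed

lemma of_real_mult_in_plane_points:
  "of_real t * (1 + 2 * omega) \<in> plane_points Vertex \<longleftrightarrow> (\<exists>m::int. t = of_int m)"
  "of_real t * (1 + 2 * omega) \<in> plane_points Edge_Centre \<longleftrightarrow> (\<exists>m::int. t = of_int m / 2 \<and> odd m)"
  "of_real t * (1 + 2 * omega) \<in> plane_points Face_Centre \<longleftrightarrow>
     (\<exists>m::int. t = of_int m / 3 \<and> \<not> 3 dvd m)"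
proof -
  have split: "of_real t * (1 + 2 * omega) = of_real t + of_real (2 * t) * omega"
    by (simp add: algebra_simps)
  \<comment> \<open>On this line the second coordinate is twice the first, so
    \<open>n = 2 * m\<close>. For face-centres, \<open>m + n = 3 * m\<close> is then divisible by 3
    automatically and only \<open>\<not> 3 dvd m\<close> remains.\<close>
  have multiples: "(\<exists>m n. t = of_int m / c \<and> 2 * t = of_int n / c \<and> Q m n) \<longleftrightarrow>
      (\<exists>m. t = of_int m / c \<and> Q m (2 * m))" if "c \<noteq> 0" for c and Q :: "int \<Rightarrow> int \<Rightarrow> bool"
  proof -
    have "2 * t = of_int n / c \<longleftrightarrow> n = 2 * m" if "t = of_int m / c" for m n :: int
    proof -
      have "2 * t = of_int n / c \<longleftrightarrow> of_int n = (of_int (2 * m) :: real)"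
        using \<open>c \<noteq> 0\<close> by (auto simp: that field_simps)
      then show ?thesis
        by (simp only: of_int_eq_iff)
    qed
    then show ?thesis
      by metis
  qed
  show "of_real t * (1 + 2 * omega) \<in> plane_points Vertex \<longleftrightarrow> (\<exists>m::int. t = of_int m)"
    unfolding split plane_points.simps(1) real_coords_in_eisenstein_iff
    using multiples[of 1 "\<lambda>_ _. True"] by (auto simp: Ints_def)
  show "of_real t * (1 + 2 * omega) \<in> plane_points Edge_Centre \<longleftrightarrow>
      (\<exists>m::int. t = of_int m / 2 \<and> odd m)"
    unfolding split real_coords_in_edge_centres_iff
    using multiples[of 2 "\<lambda>m n. \<not> (even m \<and> even n)"] by simp
  have "3 dvd m + 2 * m \<and> \<not> 3 dvd 2 * m \<longleftrightarrow> \<not> 3 dvd m" for m :: int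
    by presburger
  then show "of_real t * (1 + 2 * omega) \<in> plane_points Face_Centre \<longleftrightarrow>
      (\<exists>m::int. t = of_int m / 3 \<and> \<not> 3 dvd m)"
    unfolding split real_coords_in_face_centres_iff
    using multiples[of 3 "\<lambda>m n. 3 dvd m + n \<and> \<not> 3 dvd n"] by simp
qed

lemma ex_geo_iff: "(\<exists>s. P s) \<longleftrightarrow> P Vertex \<or> P Edge_Centre \<or> P Face_Centre"
  by (metis geo.exhaust)

lemma edge_line_points:
  "set [0, 1 / 2] = {x \<in> {0..<1::real}. \<exists>s. of_real x \<in> plane_points s}"
proof (intro equalityI subsetI)
  fix x :: real assume "x \<in> set [0, 1 / 2]"
  then show "x \<in> {x \<in> {0..<1::real}. \<exists>s. of_real x \<in> plane_points s}"
    unfolding ex_geo_iff of_real_in_plane_points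
    by (auto intro: exI[of _ 0] exI[of _ 1])
next
  fix x :: real assume "x \<in> {x \<in> {0..<1::real}. \<exists>s. of_real x \<in> plane_points s}"
  then have x: "0 \<le> x" "x < 1"
    and "(\<exists>m::int. x = of_int m) \<or> (\<exists>m::int. x = of_int m / 2 \<and> odd m)"
    unfolding ex_geo_iff using of_real_in_plane_points[of x]
    by (auto simp del: plane_points.simps)
  then show "x \<in> set [0, 1 / 2]"
  proof (elim disjE exE conjE)
    fix m :: int assume "x = of_int m"
    then have "m = 0"
      using x by linarith
    with \<open>x = of_int m\<close> show ?thesis by simp
  next
    fix m :: int assume m: "x = of_int m / 2" "odd m"
    then have "m = 0 \<or> m = 1"
      using x by linarith
    then show ?thesis
      using m by auto
  qed
qed

lemma face_line_points:
  "set [0, 1 / 3, 1 / 2, 2 / 3] =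
     {x \<in> {0..<1::real}. \<exists>s. of_real x * (1 + 2 * omega) \<in> plane_points s}"
proof (intro equalityI subsetI)
  fix x :: real assume "x \<in> set [0, 1 / 3, 1 / 2, 2 / 3]"
  then show "x \<in> {x \<in> {0..<1::real}. \<exists>s. of_real x * (1 + 2 * omega) \<in> plane_points s}"
    unfolding ex_geo_iff of_real_mult_in_plane_points
    by (auto intro: exI[of _ 0] exI[of _ 1] exI[of _ 2])
next
  fix x :: real
  assume "x \<in> {x \<in> {0..<1::real}. \<exists>s. of_real x * (1 + 2 * omega) \<in> plane_points s}"
  then have x: "0 \<le> x" "x < 1"
    and "(\<exists>m::int. x = of_int m) \<or> (\<exists>m::int. x = of_int m / 2 \<and> odd m)
      \<or> (\<exists>m::int. x = of_int m / 3 \<and> \<not> 3 dvd m)"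
    unfolding ex_geo_iff of_real_mult_in_plane_points by simp_all
  then show "x \<in> set [0, 1 / 3, 1 / 2, 2 / 3]"
  proof (elim disjE exE conjE)
    fix m :: int assume "x = of_int m"
    then have "m = 0"
      using x by linarith
    with \<open>x = of_int m\<close> show ?thesis by simp
  next
    fix m :: int assume m: "x = of_int m / 2" "odd m"
    then have "m = 0 \<or> m = 1"
      using x by linarith
    then show ?thesis
      using m by auto
  next
    fix m :: int assume m: "x = of_int m / 3" "\<not> 3 dvd m"
    then have "m = 0 \<or> m = 1 \<or> m = 2"
      using x by linarith
    then show ?thesis
      using m by auto
  qed
qed

section \<open>The pattern of a mirror in terms of the two periods of the lattice\<close>

context eisenstein_lattice
begin

lemma mirror_pattern:
  assumes f: "is_reflection \<Lambda> f" and C: "C \<in> mirrors \<Lambda> f"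
    and rotate: "\<And>\<rho> z. \<rho> \<in> cube_roots \<Longrightarrow> \<rho> * z \<in> \<Lambda> \<longleftrightarrow> z \<in> \<Lambda>"
    and K: "K > 0" "\<And>t. of_real t \<in> \<Lambda> \<longleftrightarrow> (\<exists>k::int. t = real K * of_int k)"
    and L: "L > 0" "\<And>t. of_real t * (1 + 2 * omega) \<in> \<Lambda> \<longleftrightarrow> (\<exists>k::int. t = real L * of_int k)"
  shows "has_pattern \<Lambda> C [Vertex, Edge_Centre] K \<or>
    has_pattern \<Lambda> C [Vertex, Face_Centre, Edge_Centre, Face_Centre] L"
proof -
  obtain v \<rho> d where v: "v \<in> eisenstein" and \<rho>: "\<rho> \<in> cube_roots" and d: "d \<in> {1, 1 + 2 * omega}"
    and C_eq: "C = proj \<Lambda> ` range (\<lambda>t. v + of_real t * (\<rho> * d))"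
    using mirror_is_line[OF f C] by blast
  \<comment> \<open>Moving \<rho> to the front lets the rotational symmetry of both the lattice and
    the tessellation remove it, which leaves the two standard directions.\<close>
  have swap: "of_real t * (\<rho> * d) = \<rho> * (of_real t * d)" for t
    by simp
  have "d \<in> eisenstein"
    using d int_coords_in_eisenstein[of 1 2] by auto
  then have \<rho>d: "\<rho> * d \<in> eisenstein"
    using \<rho> by (simp add: eisenstein_mult cube_roots_eisenstein)
  have line: "reads \<Lambda> C (word_power w M)"
    if "M > 0" "\<And>t. of_real t * d \<in> \<Lambda> \<longleftrightarrow> (\<exists>k::int. t = real M * of_int k)"
      and "sorted_wrt (<) os"
      and "set os = {x \<in> {0..<1}. \<exists>s. of_real x * d \<in> plane_points s}"
      and "list_all2 (\<lambda>x s. of_real x * d \<in> plane_points s) os w" for M os w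
    unfolding C_eq
    by (rule reads_line[OF v \<rho>d that(1) _ that(3)])
      (use that(2,4,5) in \<open>simp_all only: swap rotate[OF \<rho>] plane_points_rotate_iff[OF \<rho>]\<close>)
  from d consider "d = 1" | "d = 1 + 2 * omega"
    by blast
  then show ?thesis
  proof cases
    case 1
    have "reads \<Lambda> C (word_power [Vertex, Edge_Centre] K)"
    proof (rule line[OF K(1)])
      show "list_all2 (\<lambda>x s. of_real x * d \<in> plane_points s) [0, 1 / 2] [Vertex, Edge_Centre]"
        unfolding 1 list.rel_inject mult_1_right of_real_in_plane_points
        by (auto intro: exI[of _ 0] exI[of _ 1])
    qed (use K(2) edge_line_points 1 in \<open>simp_all only: mult_1_right, simp_all\<close>)
    then show ?thesis
      using word_01_primitive[OF K(1)] unfolding has_pattern_def by blast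
  next
    case 2
    have "reads \<Lambda> C (word_power [Vertex, Face_Centre, Edge_Centre, Face_Centre] L)"
    proof (rule line[OF L(1)])
      show "list_all2 (\<lambda>x s. of_real x * d \<in> plane_points s) [0, 1 / 3, 1 / 2, 2 / 3]
          [Vertex, Face_Centre, Edge_Centre, Face_Centre]"
        unfolding 2 list.rel_inject of_real_mult_in_plane_points
        by (auto intro: exI[of _ 0] exI[of _ 1] exI[of _ 2])
    qed (use L(2) face_line_points 2 in \<open>simp_all only:, simp_all\<close>)
    then show ?thesis
      using word_0212_primitive[OF L(1)] unfolding has_pattern_def by blast
  qed
qed

end

section \<open>The lattices of the two maps and their periods\<close>

lemma eisenstein_lattice_principal_ideal:
  assumes c: "c \<in> eisenstein" "c' \<in> eisenstein" "c * c' = of_nat N" and N: "N > 0"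
  shows "eisenstein_lattice ((\<lambda>x. c * x) ` eisenstein) N"
proof
  show "(\<lambda>x. c * x) ` eisenstein \<subseteq> eisenstein"
    using c by (auto intro: eisenstein_mult)
  show "0 \<in> (\<lambda>x. c * x) ` eisenstein"
    by (rule image_eqI[of _ _ 0]) simp_all
  show "x + y \<in> (\<lambda>x. c * x) ` eisenstein"
    if xy: "x \<in> (\<lambda>x. c * x) ` eisenstein" "y \<in> (\<lambda>x. c * x) ` eisenstein" for x y
  proof -
    obtain p q where "x = c * p" "y = c * q" "p \<in> eisenstein" "q \<in> eisenstein"
      using xy by blast
    then show ?thesis
      by (intro image_eqI[of _ _ "p + q"]) (simp_all add: distrib_left eisenstein_add)
  qed
  show "- x \<in> (\<lambda>x. c * x) ` eisenstein" if x: "x \<in> (\<lambda>x. c * x) ` eisenstein" for x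
  proof -
    obtain p where "x = c * p" "p \<in> eisenstein"
      using x by blast
    then show ?thesis
      by (intro image_eqI[of _ _ "- p"]) (simp_all add: eisenstein_uminus)
  qed
  \<comment> \<open>The cofactor \<open>c'\<close> serves here:
    \<open>of_nat N * x = c * (c' * x)\<close>.\<close>
  show "of_nat N * x \<in> (\<lambda>x. c * x) ` eisenstein" if "x \<in> eisenstein" for x
    using that c by (intro image_eqI[of _ _ "c' * x"]) (simp_all add: eisenstein_mult flip: c(3))
qed (fact N)

lemma principal_ideal_rotate_iff:
  assumes \<rho>: "\<rho> \<in> cube_roots"
  shows "\<rho> * z \<in> (\<lambda>x. c * x) ` eisenstein \<longleftrightarrow> z \<in> (\<lambda>x. c * x) ` eisenstein"
proof
  assume "z \<in> (\<lambda>x. c * x) ` eisenstein"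
  then obtain x where "z = c * x" "x \<in> eisenstein"
    by blast
  then show "\<rho> * z \<in> (\<lambda>x. c * x) ` eisenstein"
    using \<rho> by (intro image_eqI[of _ _ "\<rho> * x"]) (simp_all add: eisenstein_mult cube_roots_eisenstein)
next
  assume "\<rho> * z \<in> (\<lambda>x. c * x) ` eisenstein"
  then obtain x where x: "\<rho> * z = c * x" "x \<in> eisenstein"
    by blast
  have "z = cnj \<rho> * (\<rho> * z)"
    using cube_roots_mult_cnj[OF \<rho>] by (simp flip: mult.assoc)
  also have "\<dots> = c * (cnj \<rho> * x)"
    by (simp add: x)
  finally show "z \<in> (\<lambda>x. c * x) ` eisenstein"
    using \<rho> x(2)
    by (intro image_eqI[of _ _ "cnj \<rho> * x"]) (simp_all add: eisenstein_mult cube_roots_eisenstein cube_roots_cnj)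
qed

lemma real_coords_in_lattice_b_0_iff:
  "of_real x + of_real y * omega \<in> lattice_b_0 b \<longleftrightarrow>
     (\<exists>m n :: int. x = real b * of_int m \<and> y = real b * of_int n)"
proof -
  have "of_nat b * (of_int m + of_int n * omega)
      = of_real (real b * of_int m) + of_real (real b * of_int n) * omega" for m n :: int
    by (simp add: algebra_simps)
  then have "of_real x + of_real y * omega = of_nat b * (of_int m + of_int n * omega) \<longleftrightarrow>
      x = real b * of_int m \<and> y = real b * of_int n" for m n :: int
    by (simp only: real_coords_eq_iff)
  then show ?thesis
    unfolding lattice_b_0_def eisenstein_def image_iff by blast
qed

lemma real_coords_in_lattice_b_b_iff:
  "of_real x + of_real y * omega \<in> lattice_b_b b \<longleftrightarrow>
     (\<exists>m n :: int. x = real b * of_int (- m - n) \<and> y = real b * of_int (m - 2 * n))"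
proof -
  have "(- of_nat b + of_nat b * omega) * (of_int m + of_int n * omega)
      = of_real (real b * of_int (- m - n)) + of_real (real b * of_int (m - 2 * n)) * omega"
    for m n :: int
  proof -
    have "(- of_nat b + of_nat b * omega) * (of_int m + of_int n * omega)
      = of_nat b * (- of_int m + (of_int m - of_int n) * omega + of_int n * (omega * omega))"
      by (simp add: algebra_simps)
    then show ?thesis
      by (simp add: omega_square algebra_simps)
  qed
  then have "of_real x + of_real y * omega
      = (- of_nat b + of_nat b * omega) * (of_int m + of_int n * omega) \<longleftrightarrow>
      x = real b * of_int (- m - n) \<and> y = real b * of_int (m - 2 * n)" for m n :: int
    by (simp only: real_coords_eq_iff)
  then show ?thesis
    unfolding lattice_b_b_def eisenstein_def image_iff by blast
qed

lemma edge_line_period: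
  assumes "b > 0"
  shows "of_real t \<in> lattice_b_0 b \<longleftrightarrow> (\<exists>k::int. t = real b * of_int k)"
    and "of_real t \<in> lattice_b_b b \<longleftrightarrow> (\<exists>k::int. t = real (3 * b) * of_int k)"
proof -
  have split: "of_real t = of_real t + of_real 0 * omega"
    by simp
  show "of_real t \<in> lattice_b_0 b \<longleftrightarrow> (\<exists>k::int. t = real b * of_int k)"
    by (subst split, subst real_coords_in_lattice_b_0_iff) auto
  have "(\<exists>m n :: int. t = real b * of_int (- m - n) \<and> 0 = real b * of_int (m - 2 * n)) \<longleftrightarrow>
      (\<exists>k::int. t = real (3 * b) * of_int k)"
  proof
    assume "\<exists>m n :: int. t = real b * of_int (- m - n) \<and> 0 = real b * of_int (m - 2 * n)"
    then obtain m n :: int where mn: "t = real b * of_int (- m - n)" "0 = real b * of_int (m - 2 * n)"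
      by blast
    \<comment> \<open>This is the origin of the factor 3: the real coordinate \<open>- m - n\<close>
      becomes \<open>- 3 * n\<close>.\<close>
    have "m = 2 * n"
      using mn(2) assms by simp
    then have "t = real (3 * b) * of_int (- n)"
      using mn(1) by simp
    then show "\<exists>k::int. t = real (3 * b) * of_int k" ..
  next
    assume "\<exists>k::int. t = real (3 * b) * of_int k"
    then obtain k :: int where "t = real (3 * b) * of_int k"
      by blast
    then show "\<exists>m n :: int. t = real b * of_int (- m - n) \<and> 0 = real b * of_int (m - 2 * n)"
      by (intro exI[of _ "- 2 * k"] exI[of _ "- k"]) simp
  qed
  then show "of_real t \<in> lattice_b_b b \<longleftrightarrow> (\<exists>k::int. t = real (3 * b) * of_int k)"
    by (subst split, subst real_coords_in_lattice_b_b_iff)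
qed

lemma face_line_period:
  assumes "b > 0"
  shows "of_real t * (1 + 2 * omega) \<in> lattice_b_0 b \<longleftrightarrow> (\<exists>k::int. t = real b * of_int k)"
    and "of_real t * (1 + 2 * omega) \<in> lattice_b_b b \<longleftrightarrow> (\<exists>k::int. t = real b * of_int k)"
proof -
  have split: "of_real t * (1 + 2 * omega) = of_real t + of_real (2 * t) * omega"
    by (simp add: algebra_simps)
  have "2 * t = real b * of_int (2 * k)" if "t = real b * of_int k" for k :: int
    using that by simp
  then show "of_real t * (1 + 2 * omega) \<in> lattice_b_0 b \<longleftrightarrow> (\<exists>k::int. t = real b * of_int k)"
    unfolding split real_coords_in_lattice_b_0_iff by blast
  have "(\<exists>m n :: int. t = real b * of_int (- m - n) \<and> 2 * t = real b * of_int (m - 2 * n)) \<longleftrightarrow>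
      (\<exists>k::int. t = real b * of_int k)"
  proof
    assume "\<exists>k::int. t = real b * of_int k"
    then obtain k :: int where "t = real b * of_int k"
      by blast
    then show "\<exists>m n :: int. t = real b * of_int (- m - n) \<and> 2 * t = real b * of_int (m - 2 * n)"
      \<comment> \<open>The witnesses come from
        \<open>(omega - 1) * (- omega) = 1 + 2 * omega\<close>. Hence one step along this line,
        scaled by \<open>b\<close>, is already in the lattice.\<close>
      by (intro exI[of _ 0] exI[of _ "- k"]) simp
  qed blast
  then show "of_real t * (1 + 2 * omega) \<in> lattice_b_b b \<longleftrightarrow> (\<exists>k::int. t = real b * of_int k)"
    unfolding split real_coords_in_lattice_b_b_iff .
qed

theorem theorem4p2:
  fixes b :: nat
  assumes "b > 0"
  shows "(\<forall>f. is_reflection (lattice_b_0 b) f \<longrightarrow>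
            (\<forall>C \<in> mirrors (lattice_b_0 b) f.
               has_pattern (lattice_b_0 b) C [Vertex, Edge_Centre] b \<or>
               has_pattern (lattice_b_0 b) C [Vertex, Face_Centre, Edge_Centre, Face_Centre] b))
       \<and> (\<forall>f. is_reflection (lattice_b_b b) f \<longrightarrow>
            (\<forall>C \<in> mirrors (lattice_b_b b) f.
               has_pattern (lattice_b_b b) C [Vertex, Edge_Centre] (3 * b) \<or>
               has_pattern (lattice_b_b b) C [Vertex, Face_Centre, Edge_Centre, Face_Centre] b))"
proof (intro conjI allI impI ballI)
  interpret eisenstein_lattice "lattice_b_0 b" b
    unfolding lattice_b_0_def using assms
    by (intro eisenstein_lattice_principal_ideal[of _ 1]) simp_all
  show "has_pattern (lattice_b_0 b) C [Vertex, Edge_Centre] b \<or>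
      has_pattern (lattice_b_0 b) C [Vertex, Face_Centre, Edge_Centre, Face_Centre] b"
    if "is_reflection (lattice_b_0 b) f" "C \<in> mirrors (lattice_b_0 b) f" for f C
    using that assms edge_line_period(1)[OF assms] face_line_period(1)[OF assms]
    by (intro mirror_pattern) (simp_all add: lattice_b_0_def principal_ideal_rotate_iff)
next
  \<comment> \<open>The factor \<open>- 2 - omega\<close> is the conjugate of
    \<open>omega - 1\<close>, whose squared norm is 3.\<close>
  have "(- of_nat b + of_nat b * omega) * (- 2 - omega)
      = of_nat b * (2 - omega - omega * omega)"
    by (simp add: algebra_simps)
  also have "\<dots> = of_nat (3 * b)"
    by (simp add: omega_square)
  finally have norm_eq: "(- of_nat b + of_nat b * omega) * (- 2 - omega) = of_nat (3 * b)" .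
  interpret eisenstein_lattice "lattice_b_b b" "3 * b"
    unfolding lattice_b_b_def
  proof (rule eisenstein_lattice_principal_ideal[OF _ _ norm_eq])
    show "- of_nat b + of_nat b * omega \<in> eisenstein"
      by (intro eisenstein_add eisenstein_mult eisenstein_uminus) simp_all
    show "- 2 - omega \<in> eisenstein"
      using int_coords_in_eisenstein[of "- 2" "- 1"] by simp
  qed (use assms in simp)
  show "has_pattern (lattice_b_b b) C [Vertex, Edge_Centre] (3 * b) \<or>
      has_pattern (lattice_b_b b) C [Vertex, Face_Centre, Edge_Centre, Face_Centre] b"
    if "is_reflection (lattice_b_b b) f" "C \<in> mirrors (lattice_b_b b) f" for f C
    using that assms edge_line_period(2)[OF assms] face_line_period(2)[OF assms]
    by (intro mirror_pattern) (simp_all add: lattice_b_b_def principal_ideal_rotate_iff)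
qed

end
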